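(* Let $E$ be an admissible $*$-tring. Then $\Phi_r\Psi_l:\mathcal{SN}_{cs}(E_0^l)\to\mathcal{SN}_{cs}(E_0^r)$ is an isomorphism of lattices such that $\Phi_r\Psi_l(\mathcal{N}_{cs}(E_0^l))=\mathcal{N}_{cs}(E_0^r)$. The inverse of $\Phi_r\Psi_l$ is $\Phi_l\Psi_r$.
   Context: A $*$-ternary ring ($*$-tring) is a complex vector space $E$ with a map $(\cdot,\cdot,\cdot):E\times E\times E\to E$, linear in the first and third variables and conjugate linear in the second, such that $((x,y,z),u,v)=(x,(u,z,y),v)=(x,y,(z,u,v))$ for all $x,y,z,u,v\in E$. It is admissible if $(x,x,x)=0$ implies $x=0$. For an admissible $*$-tring $E$: $E_0^r=\mathrm{span}\{\langle y,z\rangle_r:y,z\in E\}$, where $\langle y,z\rangle_r:E\to E$ is $x\mapsto(x,y,z)$, is a $*$-algebra with product opposite to composition and involution determined by $\langle y,z\rangle_r^*=\langle z,y\rangle_r$, and $E$ is a right $E_0^r$-module by evaluation, so $x\langle y,z\rangle_r=(x,y,z)$. Similarly $E_0^l=\mathrm{span}\{\langle x,y\rangle_l:x,y\in E\}$, where $\langle x,y\rangle_l:E\to E$ is $z\mapsto(x,y,z)$, is a $*$-algebra with product composition and involution determined by $\langle x,y\rangle_l^*=\langle y,x\rangle_l$, and $E$ is a left $E_0^l$-module with $\langle x,y\rangle_l z=(x,y,z)$. A $C^*$-seminorm on a $*$-tring $E$ is a seminorm $\gamma$ with $\gamma((x,y,z))\le\gamma(x)\gamma(y)\gamma(z)$ and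 $\gamma((x,x,x))=\gamma(x)^3$. A $C^*$-seminorm on a $*$-algebra is a submultiplicative seminorm $\alpha$ with $\alpha(a^*a)=\alpha(a)^2$. $\mathcal{SN}(\cdot)$ and $\mathcal{N}(\cdot)$ denote the sets of $C^*$-seminorms and $C^*$-norms, ordered pointwise. For $s\in\{l,r\}$, $\mathcal{SN}_{cs}(E_0^s)$ is the set of $\alpha\in\mathcal{SN}(E_0^s)$ with $\alpha(\langle x,y\rangle_s)^2\le\alpha(\langle x,x\rangle_s)\alpha(\langle y,y\rangle_s)$ for all $x,y\in E$, and $\mathcal{N}_{cs}(E_0^s)=\mathcal{SN}_{cs}(E_0^s)\cap\mathcal{N}(E_0^s)$. The maps $\Phi_s:\mathcal{SN}(E)\to\mathcal{SN}_{cs}(E_0^s)$ and $\Psi_s:\mathcal{SN}_{cs}(E_0^s)\to\mathcal{SN}(E)$ are given by $\Phi_r(\gamma)(a)=\sup\{\gamma(xa):\gamma(x)\le1\}$, $\Phi_l(\gamma)(a)=\sup\{\gamma(ax):\gamma(x)\le1\}$, and $\Psi_s(\alpha)(x)=\alpha(\langle x,x\rangle_s)^{1/2}$. *)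

theory Defs
  imports Complex_Main "HOL-Library.Function_Algebras" "HOL-Algebra.Lattice"
begin

locale star_tring = vector_space scale
  for scale :: "complex \<Rightarrow> 'e::ab_group_add \<Rightarrow> 'e" +
  fixes tp :: "'e \<Rightarrow> 'e \<Rightarrow> 'e \<Rightarrow> 'e"
  assumes linear_first: "Vector_Spaces.linear scale scale (\<lambda>x. tp x y z)"
    and linear_third: "Vector_Spaces.linear scale scale (\<lambda>z. tp x y z)"
    and add_second: "tp x (y + y') z = tp x y z + tp x y' z"
    and scale_second: "tp x (scale c y) z = scale (cnj c) (tp x y z)"
    and assoc_middle: "tp (tp x y z) u v = tp x (tp u z y) v"
    and assoc_right: "tp (tp x y z) u v = tp x y (tp z u v)"

locale admissible_star_tring = star_tring +
  assumes admissible: "tp x x x = 0 \<Longrightarrow> x = 0"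

text \<open>Seminorms on a set \<^term>\<open>A\<close> are taken extensional (\<^term>\<open>undefined\<close> outside
  \<^term>\<open>A\<close>), so that equality and the order of functions are equality and pointwise
  order on \<^term>\<open>A\<close>.\<close>

definition seminorm_on :: "(complex \<Rightarrow> 'a \<Rightarrow> 'a) \<Rightarrow> 'a set \<Rightarrow> ('a::plus \<Rightarrow> real) \<Rightarrow> bool" where
  "seminorm_on scale A p \<longleftrightarrow> p \<in> extensional A \<and> (\<forall>a\<in>A. 0 \<le> p a) \<and>
     (\<forall>a\<in>A. \<forall>b\<in>A. p (a + b) \<le> p a + p b) \<and>
     (\<forall>c. \<forall>a\<in>A. p (scale c a) = cmod c * p a)"

definition tring_SN :: "(complex \<Rightarrow> 'e \<Rightarrow> 'e) \<Rightarrow> ('e \<Rightarrow> 'e \<Rightarrow> 'e \<Rightarrow> 'e) \<Rightarrow> ('e::plus \<Rightarrow> real) set" where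
  "tring_SN scale tp = {\<gamma>. seminorm_on scale UNIV \<gamma> \<and>
     (\<forall>x y z. \<gamma> (tp x y z) \<le> \<gamma> x * \<gamma> y * \<gamma> z) \<and> (\<forall>x. \<gamma> (tp x x x) = \<gamma> x ^ 3)}"

definition star_algebra_SN :: "(complex \<Rightarrow> 'a \<Rightarrow> 'a) \<Rightarrow> 'a set \<Rightarrow> ('a \<Rightarrow> 'a \<Rightarrow> 'a) \<Rightarrow> ('a \<Rightarrow> 'a)
    \<Rightarrow> ('a::plus \<Rightarrow> real) set" where
  "star_algebra_SN scale A mult star = {\<alpha>. seminorm_on scale A \<alpha> \<and>
     (\<forall>a\<in>A. \<forall>b\<in>A. \<alpha> (mult a b) \<le> \<alpha> a * \<alpha> b) \<and>
     (\<forall>a\<in>A. \<alpha> (mult (star a) a) = (\<alpha> a)\<^sup>2)}"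

datatype side = Left | Right

text \<open>\<^term>\<open>ip Left tp x y\<close> is \<open>\<langle>x,y\<rangle>\<^sub>l\<close> and \<^term>\<open>ip Right tp y z\<close> is \<open>\<langle>y,z\<rangle>\<^sub>r\<close>.\<close>

fun ip :: "side \<Rightarrow> ('e \<Rightarrow> 'e \<Rightarrow> 'e \<Rightarrow> 'e) \<Rightarrow> 'e \<Rightarrow> 'e \<Rightarrow> ('e \<Rightarrow> 'e)" where
  "ip Left tp x y = (\<lambda>z. tp x y z)"
| "ip Right tp y z = (\<lambda>x. tp x y z)"

fun op_mult :: "side \<Rightarrow> ('e \<Rightarrow> 'e) \<Rightarrow> ('e \<Rightarrow> 'e) \<Rightarrow> ('e \<Rightarrow> 'e)" where
  "op_mult Left a b = a \<circ> b"
| "op_mult Right a b = b \<circ> a"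

definition op_scale :: "(complex \<Rightarrow> 'e \<Rightarrow> 'e) \<Rightarrow> complex \<Rightarrow> ('e \<Rightarrow> 'e) \<Rightarrow> ('e \<Rightarrow> 'e)" where
  "op_scale scale c a = (\<lambda>x. scale c (a x))"

text \<open>The sum of operators is the pointwise one of \<^theory>\<open>HOL-Library.Function_Algebras\<close>.\<close>

definition E0 :: "side \<Rightarrow> (complex \<Rightarrow> 'e::ab_group_add \<Rightarrow> 'e) \<Rightarrow> ('e \<Rightarrow> 'e \<Rightarrow> 'e \<Rightarrow> 'e)
    \<Rightarrow> ('e \<Rightarrow> 'e) set" where
  "E0 s scale tp = module.span (op_scale scale) {ip s tp x y | x y. True}"

definition is_E0_star :: "side \<Rightarrow> (complex \<Rightarrow> 'e::ab_group_add \<Rightarrow> 'e) \<Rightarrow> ('e \<Rightarrow> 'e \<Rightarrow> 'e \<Rightarrow> 'e)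
    \<Rightarrow> (('e \<Rightarrow> 'e) \<Rightarrow> ('e \<Rightarrow> 'e)) \<Rightarrow> bool" where
  "is_E0_star s scale tp J \<longleftrightarrow> J \<in> extensional (E0 s scale tp) \<and>
     (\<forall>a\<in>E0 s scale tp. \<forall>b\<in>E0 s scale tp. J (a + b) = J a + J b) \<and>
     (\<forall>c. \<forall>a\<in>E0 s scale tp. J (op_scale scale c a) = op_scale scale (cnj c) (J a)) \<and>
     (\<forall>x y. J (ip s tp x y) = ip s tp y x)"

definition E0_star :: "side \<Rightarrow> (complex \<Rightarrow> 'e::ab_group_add \<Rightarrow> 'e) \<Rightarrow> ('e \<Rightarrow> 'e \<Rightarrow> 'e \<Rightarrow> 'e)
    \<Rightarrow> ('e \<Rightarrow> 'e) \<Rightarrow> ('e \<Rightarrow> 'e)" where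
  "E0_star s scale tp = (THE J. is_E0_star s scale tp J)"

definition SN_cs :: "side \<Rightarrow> (complex \<Rightarrow> 'e::ab_group_add \<Rightarrow> 'e) \<Rightarrow> ('e \<Rightarrow> 'e \<Rightarrow> 'e \<Rightarrow> 'e)
    \<Rightarrow> (('e \<Rightarrow> 'e) \<Rightarrow> real) set" where
  "SN_cs s scale tp =
     {\<alpha> \<in> star_algebra_SN (op_scale scale) (E0 s scale tp) (op_mult s) (E0_star s scale tp).
        \<forall>x y. (\<alpha> (ip s tp x y))\<^sup>2 \<le> \<alpha> (ip s tp x x) * \<alpha> (ip s tp y y)}"

definition N_cs :: "side \<Rightarrow> (complex \<Rightarrow> 'e::ab_group_add \<Rightarrow> 'e) \<Rightarrow> ('e \<Rightarrow> 'e \<Rightarrow> 'e \<Rightarrow> 'e)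
    \<Rightarrow> (('e \<Rightarrow> 'e) \<Rightarrow> real) set" where
  "N_cs s scale tp = {\<alpha> \<in> SN_cs s scale tp. \<forall>a\<in>E0 s scale tp. \<alpha> a = 0 \<longrightarrow> a = 0}"

text \<open>The maps are restricted to their domains. Both module actions are evaluation, so
  \<open>x a\<close> for \<open>s = r\<close> is also \<^term>\<open>a x\<close>.\<close>

definition Phi :: "side \<Rightarrow> (complex \<Rightarrow> 'e::ab_group_add \<Rightarrow> 'e) \<Rightarrow> ('e \<Rightarrow> 'e \<Rightarrow> 'e \<Rightarrow> 'e)
    \<Rightarrow> ('e \<Rightarrow> real) \<Rightarrow> ('e \<Rightarrow> 'e) \<Rightarrow> real" where
  "Phi s scale tp =
     (\<lambda>\<gamma>\<in>tring_SN scale tp. \<lambda>a\<in>E0 s scale tp. SUP x\<in>{x. \<gamma> x \<le> 1}. \<gamma> (a x))"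

definition Psi :: "side \<Rightarrow> (complex \<Rightarrow> 'e::ab_group_add \<Rightarrow> 'e) \<Rightarrow> ('e \<Rightarrow> 'e \<Rightarrow> 'e \<Rightarrow> 'e)
    \<Rightarrow> (('e \<Rightarrow> 'e) \<Rightarrow> real) \<Rightarrow> 'e \<Rightarrow> real" where
  "Psi s scale tp = (\<lambda>\<alpha>\<in>SN_cs s scale tp. \<lambda>x. sqrt (\<alpha> (ip s tp x x)))"

definition pointwise_order :: "('a \<Rightarrow> real) set \<Rightarrow> ('a \<Rightarrow> real) gorder" where
  "pointwise_order S = \<lparr>carrier = S, eq = (=), le = (\<le>)\<rparr>"

text \<open>\<^const>\<open>join_pres\<close> and \<^const>\<open>meet_pres\<close> include that both orders are lattices.\<close>

definition lattice_isomorphism :: "('a, 'c) gorder_scheme \<Rightarrow> ('b, 'd) gorder_scheme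
    \<Rightarrow> ('a \<Rightarrow> 'b) \<Rightarrow> bool" where
  "lattice_isomorphism X Y f \<longleftrightarrow>
     bij_betw f (carrier X) (carrier Y) \<and> join_pres X Y f \<and> meet_pres X Y f"

text \<open>The involution of \<open>E\<^sub>0\<^sup>s\<close> is well defined because \<open>a\<^sup>*\<close> is the unique
  adjoint of \<open>a\<close> with respect to the triple product.\<close>

lemma module_op_scale: "vector_space scale \<Longrightarrow> module (op_scale scale)"
  unfolding vector_space_def module_def op_scale_def by (simp add: fun_eq_iff)

lemma (in admissible_star_tring) ex1_E0_star: "\<exists>!J. is_E0_star s scale tp J"
proof -
  interpret op: module "op_scale scale" by (rule module_op_scale) (rule vector_space_axioms)
  let ?A = "E0 s scale tp"
  have add1: "tp (x + x') y z = tp x y z + tp x' y z"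
    and sc1: "tp (scale c x) y z = scale c (tp x y z)"
    and add3: "tp x y (z + z') = tp x y z + tp x y z'"
    and sc3: "tp x y (scale c z) = scale c (tp x y z)" for x x' y z z' c
    using linear_first[of y z] linear_third[of x y]
    by (auto simp: Vector_Spaces.linear_iff)
  define adj where "adj a b \<longleftrightarrow> (case s of
      Left \<Rightarrow> \<forall>x y z. tp x y (b z) = tp x (a y) z
    | Right \<Rightarrow> \<forall>x y z. tp (b x) y z = tp x (a y) z)" for a b :: "'a \<Rightarrow> 'a"
  have z1: "tp 0 y z = 0" and z2: "tp y 0 z = 0" and z3: "tp y z 0 = 0" for y z
    using add1[of 0 0] add_second[of y 0 0] add3[of y z 0 0] by auto
  have d1: "tp (x - x') y z = tp x y z - tp x' y z"
    and d3: "tp x y (z - z') = tp x y z - tp x y z'" for x x' y z z'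
    using add1[of "x - x'" x'] add3[of x y "z - z'" z'] by (auto simp: eq_diff_eq)
  have uniq: "b = b'" if "adj a b" "adj a b'" for a b b'
  proof
    fix x
    let ?d = "b x - b' x"
    have "tp ?d ?d ?d = 0"
      using that by (cases s) (simp_all add: adj_def d1[of "b x"] d3[of _ _ "b x"])
    from admissible[OF this] show "b x = b' x" by simp
  qed
  have adj_ip: "adj (ip s tp x y) (ip s tp y x)" for x y
    by (cases s) (simp_all add: adj_def assoc_middle flip: assoc_right)
  have adj_add: "adj (a + a') (b + b')" if "adj a b" "adj a' b'" for a b a' b'
    using that by (cases s) (simp_all add: adj_def add1 add_second add3)
  have adj_sc: "adj (op_scale scale c a) (op_scale scale (cnj c) b)" if "adj a b" for a b c
    using that by (cases s) (simp_all add: adj_def sc1 scale_second sc3 op_scale_def)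
  have ipA: "ip s tp x y \<in> ?A" for x y
    unfolding E0_def by (rule op.span_base) auto
  have addA: "a + b \<in> ?A" if "a \<in> ?A" "b \<in> ?A" for a b
    using that unfolding E0_def by (rule op.span_add)
  have scA: "op_scale scale c a \<in> ?A" if "a \<in> ?A" for a c
    using that unfolding E0_def by (rule op.span_scale)
  have ex: "\<exists>b. adj a b" if "a \<in> ?A" for a
    using that unfolding E0_def
  proof (induction rule: op.span_induct_alt)
    case base
    have "adj 0 0" by (cases s) (simp_all add: adj_def z1 z2 z3)
    then show ?case by blast
  next
    case (step c x y)
    then show ?case using adj_ip adj_add adj_sc by blast
  qed
  define J where "J = (\<lambda>a\<in>?A. THE b. adj a b)"
  have J: "J a = b" if "a \<in> ?A" "adj a b" for a b
    using that uniq by (auto simp: J_def)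
  have Jadj: "adj a (J a)" if "a \<in> ?A" for a
    using ex[OF that] J[OF that] by auto
  have "is_E0_star s scale tp J"
    unfolding is_E0_star_def
    by (intro conjI ballI allI J addA scA ipA adj_ip adj_add adj_sc Jadj)
       (simp_all add: J_def)
  moreover have "J1 = J2" if "is_E0_star s scale tp J1" "is_E0_star s scale tp J2" for J1 J2
  proof (rule extensionalityI)
    show "J1 \<in> extensional ?A" "J2 \<in> extensional ?A"
      using that by (simp_all add: is_E0_star_def)
    fix a assume "a \<in> ?A"
    let ?P = "\<lambda>a. a \<in> ?A \<and> J1 a = J2 a"
    have J12: "J1 (ip s tp u v) = J2 (ip s tp u v)" for u v
      using that by (simp add: is_E0_star_def)
    have Jsc: "?P (op_scale scale c b)" if "?P b" for c b
      using that \<open>is_E0_star s scale tp J1\<close> \<open>is_E0_star s scale tp J2\<close> scA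
      by (simp add: is_E0_star_def)
    have Jadd: "?P (b + b')" if "?P b" "?P b'" for b b'
      using that \<open>is_E0_star s scale tp J1\<close> \<open>is_E0_star s scale tp J2\<close> addA
      by (simp add: is_E0_star_def)
    have P0: "?P 0"
      using Jsc[of "ip s tp 0 0" 0] J12 ipA by simp
    have step: "?P (op_scale scale c x + y)" if "x \<in> {ip s tp x y | x y. True}" "?P y" for c x y
      using that J12 ipA Jsc Jadd by blast
    have "?P a"
      by (rule op.span_induct_alt[of a "{ip s tp x y | x y. True}" ?P])
         (use \<open>a \<in> ?A\<close> P0 step in \<open>simp_all only: E0_def\<close>)
    then show "J1 a = J2 a" ..
  qed
  ultimately show ?thesis by blast
qed

end

theory Submission
  imports Defs
begin

text \<open>On each side, \<open>\<Phi>\<close> and \<open>\<Psi>\<close> are mutually inverse order isomorphisms between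
  \<open>SN(E)\<close> and \<open>SN\<^bsub>cs\<^esub>(E\<^sub>0)\<close>; composing the two sides through \<open>SN(E)\<close> gives the result. The hard
  identity is \<open>\<Phi>(\<Psi>(\<alpha>)) = \<alpha>\<close>. No completion is needed: since \<open>b\<langle>x,y\<rangle> = \<langle>bx,y\<rangle>\<close>,
  each \<open>a\<close> in the span of the \<open>\<langle>x,y\<rangle>\<close> satisfies \<open>\<alpha>(ba) \<le> C\<^sub>a \<Phi>(\<Psi>(\<alpha>))(b)\<close> for all \<open>b\<close>,
  and for self-adjoint \<open>a\<close> applying this to powers \<open>b = a\<^sup>n\<close> removes the constant. The
  lattice operations exist because pointwise bounded suprema of \<open>C\<^sup>*\<close>-seminorms are again
  \<open>C\<^sup>*\<close>-seminorms; an infimum is the supremum of the lower bounds.\<close>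

section \<open>Lattices of real functions\<close>

lemma partial_order_pointwise_order: "partial_order (pointwise_order S)"
  by unfold_locales (auto simp: pointwise_order_def)

text \<open>The pointwise minimum of two seminorms is in general not subadditive, so meets are built
  from \<open>Sup\<close>: the common lower bounds of \<open>f\<close> and \<open>g\<close> include
  \<open>z\<close> and are bounded pointwise by \<open>f\<close>.\<close>

lemma lattice_pointwise_order:
  assumes ext: "S \<subseteq> extensional A"
    and bot: "z \<in> S" "\<And>f. f \<in> S \<Longrightarrow> z \<le> f"
    and Sup: "\<And>F. F \<subseteq> S \<Longrightarrow> F \<noteq> {} \<Longrightarrow> (\<And>a. a \<in> A \<Longrightarrow> bdd_above ((\<lambda>f. f a) ` F))
      \<Longrightarrow> (\<lambda>a\<in>A. SUP f\<in>F. f a) \<in> S"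
  shows "lattice (pointwise_order S)"
proof -
  interpret partial_order "pointwise_order S" by (rule partial_order_pointwise_order)
  let ?sup = "\<lambda>F. \<lambda>a\<in>A. SUP f\<in>F. f a :: real"
  have upper: "f \<le> ?sup F"
    if "f \<in> F" "F \<subseteq> S" "\<And>a. a \<in> A \<Longrightarrow> bdd_above ((\<lambda>f. f a) ` F)" for f F
  proof (rule le_funI)
    fix a
    \<comment> \<open>Off \<open>A\<close> both sides are \<open>undefined\<close>, by
      extensionality.\<close>
    show "f a \<le> ?sup F a"
      using that ext by (cases "a \<in> A") (auto intro: cSUP_upper simp: extensional_def)
  qed
  have least: "?sup F \<le> g" if "\<And>f. f \<in> F \<Longrightarrow> f \<le> g" "F \<noteq> {}" "g \<in> S" for F g
  proof (rule le_funI)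
    fix a
    show "?sup F a \<le> g a"
      using that ext by (cases "a \<in> A") (auto intro!: cSUP_least simp: extensional_def le_fun_def)
  qed
  show ?thesis
  proof
    fix f g assume "f \<in> carrier (pointwise_order S)" "g \<in> carrier (pointwise_order S)"
    then have fg: "f \<in> S" "g \<in> S" by (auto simp: pointwise_order_def)
    have "?sup {f, g} \<in> S"
      using fg by (intro Sup) auto
    moreover have "f \<le> ?sup {f, g}" "g \<le> ?sup {f, g}"
      by (rule upper; use fg in simp)+
    moreover have "?sup {f, g} \<le> h" if "h \<in> S" "f \<le> h" "g \<le> h" for h
      using that by (intro least) auto
    ultimately show "\<exists>s. least (pointwise_order S) s (Upper (pointwise_order S) {f, g})"
      using fg by (intro exI[of _ "?sup {f, g}"])
        (simp add: least_def Upper_def pointwise_order_def)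
    let ?F = "{h \<in> S. h \<le> f \<and> h \<le> g}"
    have F: "?F \<subseteq> S" "?F \<noteq> {}" using bot fg by auto
    have bdd: "bdd_above ((\<lambda>h. h a) ` ?F)" for a
      by (rule bdd_aboveI2[of _ _ "f a"]) (auto simp: le_fun_def)
    have "?sup ?F \<in> S"
      using F bdd by (rule Sup)
    moreover have "?sup ?F \<le> f" "?sup ?F \<le> g"
      by (rule least; use F fg in simp)+
    moreover have "h \<le> ?sup ?F" if "h \<in> ?F" for h
      using that F(1) bdd by (rule upper)
    ultimately show "\<exists>i. greatest (pointwise_order S) i (Lower (pointwise_order S) {f, g})"
      using fg by (intro exI[of _ "?sup ?F"])
        (simp add: greatest_def Lower_def pointwise_order_def)
  qed
qed

text \<open>Surjectivity writes the join in \<open>T\<close> as \<open>f w\<close>. Since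
  \<open>f\<close> reflects the order, \<open>w\<close> lies above \<open>x\<close> and
  \<open>y\<close>, which gives the inequality that monotonicity alone does not. Meets are
  dual.\<close>

lemma lattice_isomorphismI:
  assumes "lattice (pointwise_order S)" "lattice (pointwise_order T)"
    and bij: "bij_betw f S T"
    and le: "\<And>x y. x \<in> S \<Longrightarrow> y \<in> S \<Longrightarrow> f x \<le> f y \<longleftrightarrow> x \<le> y"
  shows "lattice_isomorphism (pointwise_order S) (pointwise_order T) f"
proof -
  interpret S: lattice "pointwise_order S" by fact
  interpret T: lattice "pointwise_order T" by fact
  have carr [simp]: "carrier (pointwise_order U) = U" "le (pointwise_order U) = (\<le>)"
    for U :: "('b \<Rightarrow> real) set"
    by (simp_all add: pointwise_order_def)
  have carr' [simp]: "carrier (pointwise_order U) = U" "le (pointwise_order U) = (\<le>)"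
    for U :: "('a \<Rightarrow> real) set"
    by (simp_all add: pointwise_order_def)
  have fT: "f x \<in> T" if "x \<in> S" for x
    using bij that by (auto simp: bij_betw_def)
  have surj: "\<exists>x\<in>S. y = f x" if "y \<in> T" for y
    using bij that by (auto simp: bij_betw_def)
  have join: "f (x \<squnion>\<^bsub>pointwise_order S\<^esub> y) = f x \<squnion>\<^bsub>pointwise_order T\<^esub> f y"
    if xy: "x \<in> S" "y \<in> S" for x y
  proof -
    let ?j = "x \<squnion>\<^bsub>pointwise_order S\<^esub> y"
    let ?k = "f x \<squnion>\<^bsub>pointwise_order T\<^esub> f y"
    have j: "?j \<in> S" "x \<le> ?j" "y \<le> ?j"
      using S.join_closed[of x y] S.join_left[of x y] S.join_right[of x y] xy by auto
    have k: "?k \<in> T" "f x \<le> ?k" "f y \<le> ?k"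
      using T.join_closed[of "f x" "f y"] T.join_left[of "f x" "f y"] T.join_right[of "f x" "f y"]
        xy fT by auto
    obtain w where w: "w \<in> S" "?k = f w" using surj k(1) by blast
    have "?j \<le> w"
      using S.join_le[of x w y] xy w k le by auto
    then have "f ?j \<le> ?k" using w j le by auto
    moreover have "?k \<le> f ?j"
      using T.join_le[of "f x" "f ?j" "f y"] xy j le fT by auto
    ultimately show ?thesis by (rule antisym)
  qed
  have meet: "f (x \<sqinter>\<^bsub>pointwise_order S\<^esub> y) = f x \<sqinter>\<^bsub>pointwise_order T\<^esub> f y"
    if xy: "x \<in> S" "y \<in> S" for x y
  proof -
    let ?j = "x \<sqinter>\<^bsub>pointwise_order S\<^esub> y"
    let ?k = "f x \<sqinter>\<^bsub>pointwise_order T\<^esub> f y"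
    have j: "?j \<in> S" "?j \<le> x" "?j \<le> y"
      using S.meet_closed[of x y] S.meet_left[of x y] S.meet_right[of x y] xy by auto
    have k: "?k \<in> T" "?k \<le> f x" "?k \<le> f y"
      using T.meet_closed[of "f x" "f y"] T.meet_left[of "f x" "f y"] T.meet_right[of "f x" "f y"]
        xy fT by auto
    obtain w where w: "w \<in> S" "?k = f w" using surj k(1) by blast
    have "w \<le> ?j"
      using S.meet_le[of w x y] xy w k le by auto
    then have "?k \<le> f ?j" using w j le by auto
    moreover have "f ?j \<le> ?k"
      using T.meet_le[of "f ?j" "f x" "f y"] xy j le fT by auto
    ultimately show ?thesis by (intro antisym)
  qed
  show ?thesis
    unfolding lattice_isomorphism_def join_pres_def meet_pres_def
    using assms join meet by simp
qed

section \<open>The left algebra of a ternary ring\<close>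

text \<open>The C*-identity and submultiplicativity bound the square of \<open>\<alpha> b\<close> by
  \<open>\<alpha> (J b) * \<alpha> b\<close>. Cancel \<open>\<alpha> b\<close>, then exchange
  \<open>b\<close> and \<open>J b\<close>.\<close>

lemma star_algebra_SN_star:
  assumes \<alpha>: "\<alpha> \<in> star_algebra_SN sc A mult J"
    and J: "\<And>a. a \<in> A \<Longrightarrow> J a \<in> A" "\<And>a. a \<in> A \<Longrightarrow> J (J a) = a" and a: "a \<in> A"
  shows "\<alpha> (J a) = \<alpha> a"
proof -
  have le: "\<alpha> b \<le> \<alpha> (J b)" if b: "b \<in> A" for b
  proof -
    have nn: "0 \<le> \<alpha> b" "0 \<le> \<alpha> (J b)"
      using \<alpha> J b by (simp_all add: star_algebra_SN_def seminorm_on_def)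
    have "\<alpha> b * \<alpha> b = \<alpha> (mult (J b) b)"
      using \<alpha> b by (simp add: star_algebra_SN_def power2_eq_square)
    also have "\<dots> \<le> \<alpha> (J b) * \<alpha> b"
      using \<alpha> J(1)[OF b] b unfolding star_algebra_SN_def by blast
    finally show ?thesis
      using nn by (cases "\<alpha> b = 0") auto
  qed
  show ?thesis
    using le[OF a] le[OF J(1)[OF a]] J(2)[OF a] by simp
qed

text \<open>Because the involution is isometric, the C*-identity may be stated with either order of
  the factors. This later absorbs the reversed product of the right algebra.\<close>

lemma star_algebra_SN_opposite:
  assumes J: "\<And>a. a \<in> A \<Longrightarrow> J a \<in> A" "\<And>a. a \<in> A \<Longrightarrow> J (J a) = a"
  shows "star_algebra_SN sc A (\<lambda>a b. mult b a) J = star_algebra_SN sc A mult J"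
proof -
  have le: "star_algebra_SN sc A m J \<subseteq> star_algebra_SN sc A (\<lambda>a b. m b a) J" for m
  proof
    fix \<alpha> assume \<alpha>: "\<alpha> \<in> star_algebra_SN sc A m J"
    have "\<alpha> (m a (J a)) = (\<alpha> a)\<^sup>2" if a: "a \<in> A" for a
    proof -
      have "\<alpha> (m (J (J a)) (J a)) = (\<alpha> (J a))\<^sup>2"
        using \<alpha> J(1)[OF a] by (simp add: star_algebra_SN_def)
      then show ?thesis
        using star_algebra_SN_star[OF \<alpha> J a] J(2)[OF a] by simp
    qed
    moreover have "\<alpha> (m b a) \<le> \<alpha> a * \<alpha> b" if "a \<in> A" "b \<in> A" for a b
    proof -
      have "\<alpha> (m b a) \<le> \<alpha> b * \<alpha> a" using \<alpha> that by (simp add: star_algebra_SN_def)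
      then show ?thesis by (simp add: mult.commute)
    qed
    ultimately show "\<alpha> \<in> star_algebra_SN sc A (\<lambda>a b. m b a) J"
      using \<alpha> by (simp add: star_algebra_SN_def)
  qed
  from le[of mult] le[of "\<lambda>a b. mult b a"] show ?thesis by blast
qed

section \<open>The span of the operators \<open>tp x y\<close> as an algebra with involution\<close>

context admissible_star_tring
begin

abbreviation "A \<equiv> E0 Left scale tp"
abbreviation "adj \<equiv> E0_star Left scale tp"
abbreviation "SNl \<equiv> SN_cs Left scale tp"

interpretation op: module "op_scale scale"
  by (rule module_op_scale) (rule vector_space_axioms)

lemma op_scale_apply [simp]: "op_scale scale c a x = scale c (a x)"
  by (simp add: op_scale_def)

lemma tp_add1: "tp (x + x') y z = tp x y z + tp x' y z"
  and tp_scale1: "tp (scale c x) y z = scale c (tp x y z)"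
  and tp_add3: "tp x y (z + z') = tp x y z + tp x y z'"
  and tp_scale3: "tp x y (scale c z) = scale c (tp x y z)"
  using linear_first[of y z] linear_third[of x y]
  by (auto simp: Vector_Spaces.linear_iff)

lemma tp_zero [simp]: "tp 0 y z = 0" "tp x 0 z = 0" "tp x y 0 = 0"
  using tp_add1[of 0 0] add_second[of _ 0 0] tp_add3[of _ _ 0 0] by auto

text \<open>The partial application \<open>tp x y\<close> is the generator
  \<open>ip Left tp x y\<close>; generators appear in this form from here on.\<close>

lemma tp_mem: "tp x y \<in> A"
  unfolding E0_def by (rule op.span_base) auto

lemma zero_mem: "0 \<in> A"
  unfolding E0_def by (rule op.span_zero)

lemma add_mem: "a \<in> A \<Longrightarrow> b \<in> A \<Longrightarrow> a + b \<in> A"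
  unfolding E0_def by (rule op.span_add)

lemma scale_mem: "a \<in> A \<Longrightarrow> op_scale scale c a \<in> A"
  unfolding E0_def by (rule op.span_scale)

text \<open>In applications \<open>P\<close> is given explicitly: unification would return an eta-expanded \<open>P\<close>,
  and the simplifier then unfolds \<open>0\<close> and \<open>+\<close> pointwise under \<open>P\<close>.\<close>

lemma E0_induct [consumes 1, case_names zero step]:
  assumes a: "a \<in> A" and zero: "P 0"
    and step: "\<And>c x y b. b \<in> A \<Longrightarrow> P b \<Longrightarrow> P (op_scale scale c (tp x y) + b)"
  shows "P a"
proof -
  have "a \<in> A \<and> P a"
  proof (rule op.span_induct_alt[where h = "\<lambda>a. a \<in> A \<and> P a"])
    show "a \<in> op.span {ip Left tp x y | x y. True}"
      using a by (simp add: E0_def)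
    show "0 \<in> A \<and> P 0"
      using zero zero_mem by blast
    show "op_scale scale c f + b \<in> A \<and> P (op_scale scale c f + b)"
      if "f \<in> {ip Left tp x y | x y. True}" "b \<in> A \<and> P b" for c f b
      using that step add_mem scale_mem tp_mem by fastforce
  qed
  then show ?thesis ..
qed

lemma E0_linear:
  assumes "a \<in> A"
  shows "a (x + y) = a x + a y" "a (scale c x) = scale c (a x)"
proof -
  have "(\<forall>x y. a (x + y) = a x + a y) \<and> (\<forall>c x. a (scale c x) = scale c (a x))"
    using assms
    by (induction a rule: E0_induct)
       (auto simp: tp_add3 tp_scale3 scale_right_distrib scale_left_commute)
  then show "a (x + y) = a x + a y" "a (scale c x) = scale c (a x)" by auto
qed

text \<open>On generators this is \<open>assoc_right\<close>, and both sides are linear in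
  \<open>a\<close>. It turns products with a generator into generators, hence closure under
  composition.\<close>

lemma E0_comp_tp:
  assumes "a \<in> A"
  shows "a \<circ> tp x y = tp (a x) y"
  using assms
  by (induction rule: E0_induct[where P = "\<lambda>a. a \<circ> tp x y = tp (a x) y"])
     (auto simp: fun_eq_iff tp_add1 tp_scale1 assoc_right)

lemma comp_step:
  assumes "a \<in> A"
  shows "a \<circ> (op_scale scale c (tp x y) + b) = op_scale scale c (tp (a x) y) + (a \<circ> b)"
  using E0_linear[OF assms] E0_comp_tp[OF assms] by (auto simp: fun_eq_iff)

lemma comp_zero: "a \<in> A \<Longrightarrow> a \<circ> 0 = 0"
  using E0_linear(2)[of a 0 0] by (auto simp: fun_eq_iff)

lemma comp_mem:
  assumes "a \<in> A" "b \<in> A"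
  shows "a \<circ> b \<in> A"
  using assms(2)
proof (induction rule: E0_induct[where P = "\<lambda>b. a \<circ> b \<in> A"])
  case zero
  then show ?case using assms(1) by (simp add: comp_zero zero_mem)
next
  case (step c x y b)
  then show ?case using assms(1) by (simp only: comp_step) (intro add_mem scale_mem tp_mem)
qed

lemma is_adj: "is_E0_star Left scale tp adj"
  unfolding E0_star_def using ex1_E0_star by (rule theI')

lemma adj_add: "a \<in> A \<Longrightarrow> b \<in> A \<Longrightarrow> adj (a + b) = adj a + adj b"
  and adj_scale: "a \<in> A \<Longrightarrow> adj (op_scale scale c a) = op_scale scale (cnj c) (adj a)"
  and adj_tp: "adj (tp x y) = tp y x"
  using is_adj by (simp_all add: is_E0_star_def)

lemma adj_step:
  "b \<in> A \<Longrightarrow> adj (op_scale scale c (tp x y) + b) = op_scale scale (cnj c) (tp y x) + adj b"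
  by (simp add: adj_add adj_scale adj_tp tp_mem scale_mem)

lemma adj_zero: "adj 0 = 0"
  using adj_add[OF zero_mem zero_mem] by simp

lemma adj_mem:
  assumes "a \<in> A"
  shows "adj a \<in> A"
  using assms
  by (induction rule: E0_induct[where P = "\<lambda>a. adj a \<in> A"])
     (auto simp: adj_step adj_zero intro: zero_mem add_mem scale_mem tp_mem)

lemma adj_adj:
  assumes "a \<in> A"
  shows "adj (adj a) = a"
  using assms
  by (induction rule: E0_induct[where P = "\<lambda>a. adj (adj a) = a"])
     (auto simp: adj_step adj_zero adj_mem)

text \<open>On generators this combines \<open>assoc_middle\<close> with \<open>assoc_right\<close>;
  both sides are conjugate linear in \<open>a\<close>. With \<open>E0_comp_tp\<close> it yields
  \<open>tp (a z) (a z) = a \<circ> (tp z z \<circ> adj a)\<close>, the link between the ring and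
  its algebra.\<close>

lemma tp_adj:
  assumes "a \<in> A"
  shows "tp x (a y) = tp x y \<circ> adj a"
  using assms
  by (induction rule: E0_induct[where P = "\<lambda>a. tp x (a y) = tp x y \<circ> adj a"])
     (auto simp: adj_step adj_zero fun_eq_iff add_second scale_second tp_add3
        tp_scale3 assoc_middle simp flip: assoc_right)

text \<open>For \<open>b = tp x y\<close> the left side is \<open>tp y (a x)\<close>, which
  \<open>tp_adj\<close> rewrites as \<open>tp y x \<circ> adj a\<close>.\<close>

lemma adj_comp:
  assumes "a \<in> A" "b \<in> A"
  shows "adj (a \<circ> b) = adj b \<circ> adj a"
  using assms(2)
proof (induction rule: E0_induct[where P = "\<lambda>b. adj (a \<circ> b) = adj b \<circ> adj a"])
  case zero
  then show ?case using assms(1) by (simp add: comp_zero adj_zero fun_eq_iff)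
next
  case (step c x y b)
  have "adj (a \<circ> (op_scale scale c (tp x y) + b)) = op_scale scale (cnj c) (tp y (a x)) + adj (a \<circ> b)"
    using step comp_mem[OF assms(1) step(1)] by (simp add: comp_step[OF assms(1)] adj_step)
  then show ?case using step
    by (simp add: adj_step tp_adj[OF assms(1)] fun_eq_iff)
qed

section \<open>C*-seminorms on the left algebra and their suprema\<close>

lemma SN_D:
  assumes "\<alpha> \<in> SNl"
  shows SN_ext: "\<alpha> \<in> extensional A"
    and SN_nonneg: "a \<in> A \<Longrightarrow> 0 \<le> \<alpha> a"
    and SN_add: "a \<in> A \<Longrightarrow> b \<in> A \<Longrightarrow> \<alpha> (a + b) \<le> \<alpha> a + \<alpha> b"
    and SN_scale: "a \<in> A \<Longrightarrow> \<alpha> (op_scale scale c a) = cmod c * \<alpha> a"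
    and SN_mult: "a \<in> A \<Longrightarrow> b \<in> A \<Longrightarrow> \<alpha> (a \<circ> b) \<le> \<alpha> a * \<alpha> b"
    and SN_star: "a \<in> A \<Longrightarrow> \<alpha> (adj a \<circ> a) = (\<alpha> a)\<^sup>2"
    and SN_cs: "(\<alpha> (tp x y))\<^sup>2 \<le> \<alpha> (tp x x) * \<alpha> (tp y y)"
  using assms by (auto simp: SN_cs_def star_algebra_SN_def seminorm_on_def)

lemma SN_I:
  assumes "\<alpha> \<in> extensional A"
    and "\<And>a. a \<in> A \<Longrightarrow> 0 \<le> \<alpha> a"
    and "\<And>a b. a \<in> A \<Longrightarrow> b \<in> A \<Longrightarrow> \<alpha> (a + b) \<le> \<alpha> a + \<alpha> b"
    and "\<And>c a. a \<in> A \<Longrightarrow> \<alpha> (op_scale scale c a) = cmod c * \<alpha> a"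
    and "\<And>a b. a \<in> A \<Longrightarrow> b \<in> A \<Longrightarrow> \<alpha> (a \<circ> b) \<le> \<alpha> a * \<alpha> b"
    and "\<And>a. a \<in> A \<Longrightarrow> \<alpha> (adj a \<circ> a) = (\<alpha> a)\<^sup>2"
    and "\<And>x y. (\<alpha> (tp x y))\<^sup>2 \<le> \<alpha> (tp x x) * \<alpha> (tp y y)"
  shows "\<alpha> \<in> SNl"
  using assms by (auto simp: SN_cs_def star_algebra_SN_def seminorm_on_def)

lemma SN_adj:
  assumes "\<alpha> \<in> SNl" "a \<in> A"
  shows "\<alpha> (adj a) = \<alpha> a"
proof -
  have "\<alpha> \<in> star_algebra_SN (op_scale scale) A (op_mult Left) adj"
    using assms(1) by (simp add: SN_cs_def)
  from star_algebra_SN_star[OF this adj_mem adj_adj assms(2)] show ?thesis .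
qed

lemma SN_zero:
  assumes "\<alpha> \<in> SNl"
  shows "\<alpha> 0 = 0"
  using SN_scale[OF assms zero_mem, of 0] by (simp add: op.scale_zero_left)

lemma SN_bot: "(\<lambda>a\<in>A. 0) \<in> SNl"
  by (rule SN_I) (auto simp: add_mem scale_mem comp_mem adj_mem tp_mem)

text \<open>Each upper bound in the axioms is monotone in the nonnegative values of the seminorm, so
  it passes to the supremum. Homogeneity and the C*-identity also need a reverse inequality.\<close>

lemma SN_Sup:
  assumes F: "F \<subseteq> SNl" "F \<noteq> {}" and bdd: "\<And>a. a \<in> A \<Longrightarrow> bdd_above ((\<lambda>\<alpha>. \<alpha> a) ` F)"
  shows "(\<lambda>a\<in>A. SUP \<alpha>\<in>F. \<alpha> a) \<in> SNl"
proof -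
  let ?s = "\<lambda>a. SUP \<alpha>\<in>F. \<alpha> a"
  have ub: "\<alpha> a \<le> ?s a" if "\<alpha> \<in> F" "a \<in> A" for \<alpha> a
    using that bdd by (auto intro: cSUP_upper)
  have lub: "?s a \<le> u" if "\<And>\<alpha>. \<alpha> \<in> F \<Longrightarrow> \<alpha> a \<le> u" for a u
    using F that by (auto intro: cSUP_least)
  obtain \<alpha>0 where \<alpha>0: "\<alpha>0 \<in> F" using F by blast
  have FD: "\<alpha> \<in> SNl" if "\<alpha> \<in> F" for \<alpha> using F that by blast
  have nn: "0 \<le> ?s a" if "a \<in> A" for a
    using ub[OF \<alpha>0 that] SN_nonneg[OF FD[OF \<alpha>0] that] by linarith
  show ?thesis
  proof (rule SN_I)
    fix a b assume ab: "a \<in> A" "b \<in> A"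
    have "?s (a + b) \<le> ?s a + ?s b"
    proof (rule lub)
      fix \<alpha> assume \<alpha>: "\<alpha> \<in> F"
      show "\<alpha> (a + b) \<le> ?s a + ?s b"
        using SN_add[OF FD[OF \<alpha>] ab] ub[OF \<alpha> ab(1)] ub[OF \<alpha> ab(2)] by linarith
    qed
    then show "(\<lambda>a\<in>A. ?s a) (a + b) \<le> (\<lambda>a\<in>A. ?s a) a + (\<lambda>a\<in>A. ?s a) b"
      using ab by (simp add: add_mem)
    have "?s (a \<circ> b) \<le> ?s a * ?s b"
    proof (rule lub)
      fix \<alpha> assume \<alpha>: "\<alpha> \<in> F"
      have "\<alpha> a * \<alpha> b \<le> ?s a * ?s b"
        using ub[OF \<alpha> ab(1)] ub[OF \<alpha> ab(2)] nn[OF ab(1)] SN_nonneg[OF FD[OF \<alpha>] ab(2)]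
        by (rule mult_mono)
      then show "\<alpha> (a \<circ> b) \<le> ?s a * ?s b"
        using SN_mult[OF FD[OF \<alpha>] ab] by linarith
    qed
    then show "(\<lambda>a\<in>A. ?s a) (a \<circ> b) \<le> (\<lambda>a\<in>A. ?s a) a * (\<lambda>a\<in>A. ?s a) b"
      using ab by (simp add: comp_mem)
  next
    fix a c assume a: "a \<in> A"
    have "?s (op_scale scale c a) = cmod c * ?s a"
    proof (cases "c = 0")
      case True
      have "?s (0 :: 'a \<Rightarrow> 'a) = (SUP \<alpha>\<in>F. 0)"
        by (intro SUP_cong refl SN_zero FD)
      then show ?thesis using F True by (simp add: op.scale_zero_left)
    next
      case False
      have "?s (op_scale scale c a) = (SUP \<alpha>\<in>F. cmod c * \<alpha> a)"
        using SN_scale[OF FD a] by (intro SUP_cong) auto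
      also have "\<dots> \<le> cmod c * ?s a"
        using F(2) by (rule cSUP_least) (simp add: ub[OF _ a] mult_left_mono)
      finally have le: "?s (op_scale scale c a) \<le> cmod c * ?s a" .
      have "?s a \<le> ?s (op_scale scale c a) / cmod c"
      proof (rule lub)
        fix \<alpha> assume "\<alpha> \<in> F"
        then have "cmod c * \<alpha> a \<le> ?s (op_scale scale c a)"
          using SN_scale[OF FD a, of \<alpha> c] ub[OF _ scale_mem[OF a], of \<alpha> c] by simp
        then show "\<alpha> a \<le> ?s (op_scale scale c a) / cmod c"
          using False by (simp add: field_simps)
      qed
      then show ?thesis using le False by (simp add: field_simps)
    qed
    then show "(\<lambda>a\<in>A. ?s a) (op_scale scale c a) = cmod c * (\<lambda>a\<in>A. ?s a) a"
      using a by (simp add: scale_mem)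
  next
    fix a assume a: "a \<in> A"
    have m: "adj a \<circ> a \<in> A" using a by (simp add: comp_mem adj_mem)
    have "?s (adj a \<circ> a) \<le> (?s a)\<^sup>2"
      by (rule lub) (simp add: SN_star[OF FD a] ub[OF _ a] SN_nonneg[OF FD a] power_mono)
    \<comment> \<open>Taking the root first leaves a plain bound on \<open>\<alpha> a\<close>, to
      which \<open>lub\<close> applies; Cauchy-Schwarz below is treated in the same way.\<close>
    moreover have "?s a \<le> sqrt (?s (adj a \<circ> a))"
      by (rule lub, rule real_le_rsqrt) (simp add: ub[OF _ m] flip: SN_star[OF FD a])
    then have "(?s a)\<^sup>2 \<le> ?s (adj a \<circ> a)"
      using nn[OF a] nn[OF m] by (metis power_mono real_sqrt_pow2)
    ultimately show "(\<lambda>a\<in>A. ?s a) (adj a \<circ> a) = ((\<lambda>a\<in>A. ?s a) a)\<^sup>2"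
      using a m by simp
    show "0 \<le> (\<lambda>a\<in>A. ?s a) a" using a nn by simp
  next
    fix x y
    have "?s (tp x y) \<le> sqrt (?s (tp x x) * ?s (tp y y))"
    proof (rule lub, rule real_le_rsqrt)
      fix \<alpha> assume \<alpha>: "\<alpha> \<in> F"
      have "(\<alpha> (tp x y))\<^sup>2 \<le> \<alpha> (tp x x) * \<alpha> (tp y y)"
        using SN_cs[OF FD[OF \<alpha>]] .
      also have "\<dots> \<le> ?s (tp x x) * ?s (tp y y)"
        using ub[OF \<alpha> tp_mem] ub[OF \<alpha> tp_mem] nn[OF tp_mem] SN_nonneg[OF FD[OF \<alpha>] tp_mem]
        by (rule mult_mono)
      finally show "(\<alpha> (tp x y))\<^sup>2 \<le> ?s (tp x x) * ?s (tp y y)" .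
    qed
    then have "(?s (tp x y))\<^sup>2 \<le> ?s (tp x x) * ?s (tp y y)"
      using nn tp_mem by (metis mult_nonneg_nonneg power_mono real_sqrt_pow2)
    then show "((\<lambda>a\<in>A. ?s a) (tp x y))\<^sup>2
        \<le> (\<lambda>a\<in>A. ?s a) (tp x x) * (\<lambda>a\<in>A. ?s a) (tp y y)"
      by (simp add: tp_mem)
  qed simp
qed

lemma SN_lattice: "lattice (pointwise_order SNl)"
proof (rule lattice_pointwise_order)
  show "SNl \<subseteq> extensional A" using SN_ext by blast
  show "(\<lambda>a\<in>A. 0) \<in> SNl" by (rule SN_bot)
  show "(\<lambda>a\<in>A. 0) \<le> \<alpha>" if "\<alpha> \<in> SNl" for \<alpha>
    using SN_nonneg[OF that] SN_ext[OF that] by (auto simp: le_fun_def extensional_def)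
qed (rule SN_Sup)

section \<open>Seminorms on the ternary ring\<close>

lemma Psi_eq: "\<alpha> \<in> SNl \<Longrightarrow> Psi Left scale tp \<alpha> x = sqrt (\<alpha> (tp x x))"
  by (simp add: Psi_def)

lemma tring_SN_D:
  assumes "\<gamma> \<in> tring_SN scale tp"
  shows tring_nonneg: "0 \<le> \<gamma> x"
    and tring_add: "\<gamma> (x + y) \<le> \<gamma> x + \<gamma> y"
    and tring_scale: "\<gamma> (scale c x) = cmod c * \<gamma> x"
    and tring_tp: "\<gamma> (tp x y z) \<le> \<gamma> x * \<gamma> y * \<gamma> z"
    and tring_cube: "\<gamma> (tp x x x) = \<gamma> x ^ 3"
  using assms by (auto simp: tring_SN_def seminorm_on_def)

lemma SN_tp_le:
  assumes "\<alpha> \<in> SNl"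
  shows "\<alpha> (tp x y) \<le> sqrt (\<alpha> (tp x x)) * sqrt (\<alpha> (tp y y))"
  using SN_cs[OF assms, of x y] SN_nonneg[OF assms tp_mem]
  by (metis real_le_rsqrt real_sqrt_mult)

lemma SN_selfadj_square:
  assumes "\<alpha> \<in> SNl" "h \<in> A" "adj h = h"
  shows "\<alpha> (h \<circ> h) = (\<alpha> h)\<^sup>2"
  using SN_star[OF assms(1,2)] assms(3) by simp

text \<open>Cauchy-Schwarz gives subadditivity, as for the norm of an inner product. The ternary
  inequality and the cube identity both come from factoring \<open>tp (tp x y z) (tp x y z)\<close>
  in the algebra.\<close>

lemma Psi_tring_SN:
  assumes \<alpha>: "\<alpha> \<in> SNl"
  shows "Psi Left scale tp \<alpha> \<in> tring_SN scale tp"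
proof -
  let ?g = "Psi Left scale tp \<alpha>"
  note g = Psi_eq[OF \<alpha>]
  note nn = SN_nonneg[OF \<alpha>]
  have nn': "0 \<le> \<alpha> (tp x y)" for x y by (rule nn[OF tp_mem])
  have add: "?g (x + y) \<le> ?g x + ?g y" for x y
  proof -
    have "tp (x + y) (x + y) = (tp x x + tp x y) + (tp y x + tp y y)"
      by (simp add: fun_eq_iff tp_add1 add_second add_ac)
    then have "\<alpha> (tp (x + y) (x + y)) \<le> (\<alpha> (tp x x) + \<alpha> (tp x y)) + (\<alpha> (tp y x) + \<alpha> (tp y y))"
      using SN_add[OF \<alpha> add_mem[OF tp_mem tp_mem] add_mem[OF tp_mem tp_mem], of x x x y y x y y]
        SN_add[OF \<alpha> tp_mem tp_mem, of x x x y] SN_add[OF \<alpha> tp_mem tp_mem, of y x y y]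
      by simp
    also have "\<dots> \<le> (?g x + ?g y)\<^sup>2"
      using SN_tp_le[OF \<alpha>, of x y] SN_tp_le[OF \<alpha>, of y x] nn'
      by (simp add: g power2_sum algebra_simps)
    finally show ?thesis
      using nn' by (simp add: g real_le_lsqrt)
  qed
  have sc: "?g (scale c x) = cmod c * ?g x" for c x
  proof -
    have "tp (scale c x) (scale c x) = op_scale scale (complex_of_real ((cmod c)\<^sup>2)) (tp x x)"
      by (simp add: fun_eq_iff tp_scale1 scale_second complex_norm_square mult.commute
          del: of_real_power)
    then show ?thesis
      using SN_scale[OF \<alpha> tp_mem]
      by (simp add: g real_sqrt_mult norm_mult norm_power)
  qed
  have ip: "tp (tp x y z) (tp x y z) = tp x y \<circ> (tp z z \<circ> tp y x)" for x y z
    using tp_adj[OF tp_mem, of "tp x y z" x y z] E0_comp_tp[OF tp_mem, of x y z z]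
    by (simp add: adj_tp fun.map_comp o_assoc)
  have mult: "?g (tp x y z) \<le> ?g x * ?g y * ?g z" for x y z
  proof -
    have "\<alpha> (tp (tp x y z) (tp x y z)) \<le> \<alpha> (tp x y) * \<alpha> (tp z z \<circ> tp y x)"
      unfolding ip by (rule SN_mult[OF \<alpha>]) (simp_all add: tp_mem comp_mem)
    also have "\<dots> \<le> \<alpha> (tp x y) * (\<alpha> (tp z z) * \<alpha> (tp y x))"
      by (intro mult_left_mono SN_mult[OF \<alpha>] tp_mem nn')
    also have "\<alpha> (tp y x) = \<alpha> (tp x y)"
      using SN_adj[OF \<alpha> tp_mem, of x y] by (simp add: adj_tp)
    also have "\<alpha> (tp x y) * (\<alpha> (tp z z) * \<alpha> (tp x y)) = (\<alpha> (tp x y))\<^sup>2 * \<alpha> (tp z z)"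
      by (simp add: power2_eq_square)
    also have "\<dots> \<le> (\<alpha> (tp x x) * \<alpha> (tp y y)) * \<alpha> (tp z z)"
      by (intro mult_right_mono SN_cs[OF \<alpha>] nn')
    finally show ?thesis
      by (simp add: g flip: real_sqrt_mult)
  qed
  have cube: "?g (tp x x x) = ?g x ^ 3" for x
  proof -
    let ?h = "tp x x"
    have h: "?h \<in> A" "adj ?h = ?h" "?h \<circ> ?h \<in> A" "adj (?h \<circ> ?h) = ?h \<circ> ?h"
        "?h \<circ> (?h \<circ> ?h) \<in> A"
      by (simp_all add: tp_mem comp_mem adj_tp adj_comp)
    have "\<alpha> (?h \<circ> (?h \<circ> ?h)) = \<alpha> ?h ^ 3"
    proof (rule antisym)
      have "\<alpha> (?h \<circ> (?h \<circ> ?h)) \<le> \<alpha> ?h * \<alpha> (?h \<circ> ?h)"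
        by (intro SN_mult[OF \<alpha>] h)
      then show "\<alpha> (?h \<circ> (?h \<circ> ?h)) \<le> \<alpha> ?h ^ 3"
        by (simp add: SN_selfadj_square[OF \<alpha> h(1,2)] power2_eq_square power3_eq_cube)
      \<comment> \<open>Squaring self-adjoint elements reaches the fourth power but not the third,
        so the cube is bounded below by splitting one factor off the fourth power.\<close>
      have "\<alpha> ?h ^ 3 * \<alpha> ?h = \<alpha> ((?h \<circ> ?h) \<circ> (?h \<circ> ?h))"
        by (simp only: SN_selfadj_square[OF \<alpha> h(3,4)] SN_selfadj_square[OF \<alpha> h(1,2)])
          (simp add: power2_eq_square power3_eq_cube)
      also have "\<dots> = \<alpha> ((?h \<circ> (?h \<circ> ?h)) \<circ> ?h)"
        by (simp add: o_assoc)
      also have "\<dots> \<le> \<alpha> (?h \<circ> (?h \<circ> ?h)) * \<alpha> ?h"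
        by (intro SN_mult[OF \<alpha>] h)
      finally show "\<alpha> ?h ^ 3 \<le> \<alpha> (?h \<circ> (?h \<circ> ?h))"
        using nn[OF h(1)] nn[OF h(5)] by (cases "\<alpha> ?h = 0") auto
    qed
    then show ?thesis
      by (simp only: g ip) (simp add: real_sqrt_power)
  qed
  show ?thesis
    unfolding tring_SN_def seminorm_on_def
    using add sc mult cube nn' by (auto simp: g)
qed

section \<open>The operator seminorm of a ternary seminorm\<close>

text \<open>This makes the supremum in \<open>Phi\<close> a genuine one: \<open>tp x y\<close> has
  the bound \<open>\<gamma> x * \<gamma> y\<close>, and bounds add along linear
  combinations.\<close>

lemma E0_bounded:
  assumes \<gamma>: "\<gamma> \<in> tring_SN scale tp" and "a \<in> A"
  shows "\<exists>C\<ge>0. \<forall>z. \<gamma> (a z) \<le> C * \<gamma> z"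
  using assms(2)
proof (induction rule: E0_induct[where P = "\<lambda>a. \<exists>C\<ge>0. \<forall>z. \<gamma> (a z) \<le> C * \<gamma> z"])
  case zero
  have "\<gamma> 0 = 0" using tring_scale[OF \<gamma>, of 0 0] by simp
  then show ?case by (intro exI[of _ 0]) simp
next
  case (step c x y b)
  then obtain C where C: "0 \<le> C" "\<And>z. \<gamma> (b z) \<le> C * \<gamma> z" by blast
  let ?D = "cmod c * (\<gamma> x * \<gamma> y) + C"
  have "\<gamma> ((op_scale scale c (tp x y) + b) z) \<le> ?D * \<gamma> z" for z
  proof -
    have "\<gamma> ((op_scale scale c (tp x y) + b) z) \<le> cmod c * \<gamma> (tp x y z) + \<gamma> (b z)"
      using tring_add[OF \<gamma>, of "scale c (tp x y z)" "b z"] by (simp add: tring_scale[OF \<gamma>])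
    also have "\<dots> \<le> cmod c * (\<gamma> x * \<gamma> y * \<gamma> z) + C * \<gamma> z"
      using C tring_tp[OF \<gamma>] by (intro add_mono mult_left_mono) auto
    finally show ?thesis by (simp add: algebra_simps)
  qed
  moreover have "0 \<le> ?D" using C tring_nonneg[OF \<gamma>] by simp
  ultimately show ?case by blast
qed

lemma Phi_eq:
  "\<gamma> \<in> tring_SN scale tp \<Longrightarrow> a \<in> A \<Longrightarrow> Phi Left scale tp \<gamma> a = (SUP x\<in>{x. \<gamma> x \<le> 1}. \<gamma> (a x))"
  by (simp add: Phi_def)

text \<open>Together with \<open>Phi_least\<close> this characterizes \<open>Phi\<close> as the
  least operator bound, so that later arguments need not handle the supremum.\<close>

lemma Phi_upper:
  assumes \<gamma>: "\<gamma> \<in> tring_SN scale tp" and a: "a \<in> A"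
  shows "\<gamma> (a z) \<le> Phi Left scale tp \<gamma> a * \<gamma> z"
proof -
  obtain C where C: "0 \<le> C" "\<And>z. \<gamma> (a z) \<le> C * \<gamma> z" using E0_bounded[OF assms] by blast
  show ?thesis
  proof (cases "\<gamma> z = 0")
    \<comment> \<open>Such a \<open>z\<close> cannot be normalized, but the bound \<open>C\<close>
      already forces \<open>\<gamma> (a z)\<close> to vanish.\<close>
    case True
    then show ?thesis using C(2)[of z] by simp
  next
    case False
    then have z: "0 < \<gamma> z" using tring_nonneg[OF \<gamma>, of z] by simp
    let ?c = "complex_of_real (1 / \<gamma> z)"
    have sc: "\<gamma> (scale ?c x) = \<gamma> x / \<gamma> z" for x
      using z tring_scale[OF \<gamma>, of ?c x] by (simp add: norm_divide)
    have "bdd_above ((\<lambda>x. \<gamma> (a x)) ` {x. \<gamma> x \<le> 1})"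
    proof (rule bdd_aboveI2)
      fix x assume "x \<in> {x. \<gamma> x \<le> 1}"
      then have "C * \<gamma> x \<le> C * 1" using C by (intro mult_left_mono) auto
      then show "\<gamma> (a x) \<le> C" using C(2)[of x] by simp
    qed
    then have "\<gamma> (a (scale ?c z)) \<le> Phi Left scale tp \<gamma> a"
      unfolding Phi_eq[OF assms] using sc[of z] z by (intro cSUP_upper) auto
    then show ?thesis
      using z by (simp only: E0_linear[OF a] sc) (simp add: field_simps)
  qed
qed

lemma Phi_least:
  assumes \<gamma>: "\<gamma> \<in> tring_SN scale tp" and a: "a \<in> A"
    and C: "0 \<le> C" "\<And>z. \<gamma> (a z) \<le> C * \<gamma> z"
  shows "Phi Left scale tp \<gamma> a \<le> C"
  unfolding Phi_eq[OF \<gamma> a]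
proof (rule cSUP_least)
  show "{x. \<gamma> x \<le> 1} \<noteq> {}"
    using tring_scale[OF \<gamma>, of 0 0] by (auto intro!: exI[of _ 0])
  fix x assume "x \<in> {x. \<gamma> x \<le> 1}"
  then have "C * \<gamma> x \<le> C * 1" using C by (intro mult_left_mono) auto
  then show "\<gamma> (a x) \<le> C" using C(2)[of x] by simp
qed

lemma Phi_nonneg:
  assumes \<gamma>: "\<gamma> \<in> tring_SN scale tp" and a: "a \<in> A"
  shows "0 \<le> Phi Left scale tp \<gamma> a"
proof (cases "\<exists>z. \<gamma> z \<noteq> 0")
  case True
  then obtain z where "0 < \<gamma> z" using tring_nonneg[OF \<gamma>] by (metis less_eq_real_def)
  then show ?thesis
    using Phi_upper[OF assms, of z] tring_nonneg[OF \<gamma>, of "a z"]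
    by (metis mult_less_0_iff not_less order_trans)
next
  \<comment> \<open>Now \<open>\<gamma>\<close> is identically zero, so the supremum runs over a
    constant family.\<close>
  case False
  then show ?thesis by (simp add: Phi_eq[OF assms])
qed

text \<open>The cube identity at \<open>a z\<close> supplies the lower bound: \<open>tp_adj\<close>
  moves one \<open>a\<close> across, so
  \<open>tp (a z) (a z) (a z) = tp (a z) z ((adj a \<circ> a) z)\<close>, and one factor
  \<open>\<gamma> (a z)\<close> cancels.\<close>

lemma Phi_star:
  assumes \<gamma>: "\<gamma> \<in> tring_SN scale tp" and a: "a \<in> A"
  shows "(Phi Left scale tp \<gamma> a)\<^sup>2 \<le> Phi Left scale tp \<gamma> (adj a \<circ> a)"
proof -
  let ?p = "Phi Left scale tp \<gamma>"
  have m: "adj a \<circ> a \<in> A" using a by (simp add: comp_mem adj_mem)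
  have "\<gamma> (a z) \<le> sqrt (?p (adj a \<circ> a)) * \<gamma> z" for z
  proof (cases "\<gamma> (a z) = 0")
    case True
    then show ?thesis
      using Phi_nonneg[OF \<gamma> m] tring_nonneg[OF \<gamma>] by simp
  next
    case False
    have "tp (a z) (a z) (a z) = tp (a z) z ((adj a \<circ> a) z)"
      using tp_adj[OF a, of "a z" z] by simp
    then have "\<gamma> (a z) ^ 3 \<le> \<gamma> (a z) * \<gamma> z * \<gamma> ((adj a \<circ> a) z)"
      using tring_cube[OF \<gamma>, of "a z"] tring_tp[OF \<gamma>] by metis
    also have "\<dots> \<le> \<gamma> (a z) * \<gamma> z * (?p (adj a \<circ> a) * \<gamma> z)"
      using tring_nonneg[OF \<gamma>] by (intro mult_left_mono Phi_upper[OF \<gamma> m]) simp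
    finally have "\<gamma> (a z) * (\<gamma> (a z))\<^sup>2 \<le> \<gamma> (a z) * (?p (adj a \<circ> a) * (\<gamma> z)\<^sup>2)"
      by (simp add: power2_eq_square power3_eq_cube algebra_simps)
    then have "(\<gamma> (a z))\<^sup>2 \<le> ?p (adj a \<circ> a) * (\<gamma> z)\<^sup>2"
      using False tring_nonneg[OF \<gamma>, of "a z"] by simp
    then show ?thesis
      using tring_nonneg[OF \<gamma>, of z]
      by (metis real_le_rsqrt real_sqrt_mult real_sqrt_abs abs_of_nonneg)
  qed
  then have "?p a \<le> sqrt (?p (adj a \<circ> a))"
    using Phi_nonneg[OF \<gamma> m] by (intro Phi_least[OF \<gamma> a]) auto
  then show ?thesis
    using Phi_nonneg[OF \<gamma> a] Phi_nonneg[OF \<gamma> m] by (metis power_mono real_sqrt_pow2)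
qed

lemma Phi_tp_le:
  assumes \<gamma>: "\<gamma> \<in> tring_SN scale tp"
  shows "Phi Left scale tp \<gamma> (tp x y) \<le> \<gamma> x * \<gamma> y"
  using tring_tp[OF \<gamma>] tring_nonneg[OF \<gamma>] by (intro Phi_least[OF \<gamma> tp_mem]) simp_all

text \<open>By the cube identity, applying the operator to \<open>x\<close> itself attains the bound
  of \<open>Phi_tp_le\<close>. This makes \<open>Psi\<close> a left inverse of
  \<open>Phi\<close>.\<close>

lemma Phi_tp_same:
  assumes \<gamma>: "\<gamma> \<in> tring_SN scale tp"
  shows "Phi Left scale tp \<gamma> (tp x x) = (\<gamma> x)\<^sup>2"
proof (rule antisym)
  show "Phi Left scale tp \<gamma> (tp x x) \<le> (\<gamma> x)\<^sup>2"
    using Phi_tp_le[OF \<gamma>] by (simp add: power2_eq_square)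
  have "(\<gamma> x)\<^sup>2 * \<gamma> x \<le> Phi Left scale tp \<gamma> (tp x x) * \<gamma> x"
    using Phi_upper[OF \<gamma> tp_mem, of x x x] tring_cube[OF \<gamma>, of x]
    by (simp add: power2_eq_square power3_eq_cube)
  then show "(\<gamma> x)\<^sup>2 \<le> Phi Left scale tp \<gamma> (tp x x)"
    using Phi_nonneg[OF \<gamma> tp_mem] tring_nonneg[OF \<gamma>, of x] by (cases "\<gamma> x = 0") auto
qed

text \<open>Cauchy-Schwarz holds because \<open>Phi_tp_le\<close> bounds the mixed term by
  \<open>\<gamma> x * \<gamma> y\<close>, while the diagonal terms are exactly the squares.\<close>

lemma Phi_SN:
  assumes \<gamma>: "\<gamma> \<in> tring_SN scale tp"
  shows "Phi Left scale tp \<gamma> \<in> SNl"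
proof -
  let ?p = "Phi Left scale tp \<gamma>"
  note nn = Phi_nonneg[OF \<gamma>] and up = Phi_upper[OF \<gamma>]
  have mult: "?p (a \<circ> b) \<le> ?p a * ?p b" if ab: "a \<in> A" "b \<in> A" for a b
  proof (rule Phi_least[OF \<gamma> comp_mem[OF ab]])
    show "0 \<le> ?p a * ?p b" using nn ab by simp
    fix z
    have "\<gamma> (a (b z)) \<le> ?p a * \<gamma> (b z)" by (rule up[OF ab(1)])
    also have "\<dots> \<le> ?p a * (?p b * \<gamma> z)" by (intro mult_left_mono up nn ab)
    finally show "\<gamma> ((a \<circ> b) z) \<le> ?p a * ?p b * \<gamma> z" by simp
  qed
  \<comment> \<open>\<open>Phi_star\<close> is only one half of the C*-identity. It first makes
    \<open>adj\<close> isometric, and then \<open>mult\<close> gives the other half.\<close>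
  have adj_ge: "?p a \<le> ?p (adj a)" if a: "a \<in> A" for a
  proof (cases "?p a = 0")
    case True
    then show ?thesis using nn adj_mem a by simp
  next
    case False
    have "?p a * ?p a \<le> ?p (adj a) * ?p a"
      using Phi_star[OF \<gamma> a] mult[OF adj_mem[OF a] a] by (simp add: power2_eq_square)
    then show ?thesis using False nn[OF a] by simp
  qed
  have adj_eq: "?p (adj a) = ?p a" if "a \<in> A" for a
    using adj_ge[OF that] adj_ge[OF adj_mem[OF that]] adj_adj[OF that] by simp
  have sc_le: "?p (op_scale scale c a) \<le> cmod c * ?p a" if a: "a \<in> A" for c a
    using nn[OF a] up[OF a] tring_scale[OF \<gamma>]
    by (intro Phi_least[OF \<gamma> scale_mem[OF a]]) (auto simp: mult.assoc intro: mult_left_mono)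
  show ?thesis
  proof (rule SN_I)
    show "?p \<in> extensional A" using \<gamma> by (simp add: Phi_def)
  next
    fix a b assume ab: "a \<in> A" "b \<in> A"
    show "?p (a + b) \<le> ?p a + ?p b"
    proof (rule Phi_least[OF \<gamma> add_mem[OF ab]])
      fix z
      show "\<gamma> ((a + b) z) \<le> (?p a + ?p b) * \<gamma> z"
        using tring_add[OF \<gamma>, of "a z" "b z"] up[OF ab(1), of z] up[OF ab(2), of z]
        by (simp add: distrib_right)
    qed (use nn ab in simp)
    show "?p (a \<circ> b) \<le> ?p a * ?p b" using ab by (rule mult)
  next
    fix c a assume a: "a \<in> A"
    show "0 \<le> ?p a" using a by (rule nn)
    show "?p (op_scale scale c a) = cmod c * ?p a"
    proof (cases "c = 0")
      case True
      then show ?thesis using sc_le[OF a, of c] nn[OF scale_mem[OF a], of c] True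
        by (intro antisym) auto
    next
      case False
      have "a = op_scale scale (inverse c) (op_scale scale c a)"
        using False by (intro ext) simp
      then have "?p a \<le> cmod (inverse c) * ?p (op_scale scale c a)"
        using sc_le[OF scale_mem[OF a]] by metis
      then have "cmod c * ?p a \<le> ?p (op_scale scale c a)"
        using False by (simp add: norm_inverse norm_divide field_simps)
      then show ?thesis using sc_le[OF a, of c] by simp
    qed
    show "?p (adj a \<circ> a) = (?p a)\<^sup>2"
      using Phi_star[OF \<gamma> a] mult[OF adj_mem[OF a] a] adj_eq[OF a]
      by (simp add: power2_eq_square)
  next
    fix x y
    have "(?p (tp x y))\<^sup>2 \<le> (\<gamma> x * \<gamma> y)\<^sup>2"
      using Phi_tp_le[OF \<gamma>] nn[OF tp_mem] by (rule power_mono)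
    then show "(?p (tp x y))\<^sup>2 \<le> ?p (tp x x) * ?p (tp y y)"
      by (simp add: Phi_tp_same[OF \<gamma>] power_mult_distrib)
  qed
qed

lemma Psi_Phi:
  assumes \<gamma>: "\<gamma> \<in> tring_SN scale tp"
  shows "Psi Left scale tp (Phi Left scale tp \<gamma>) = \<gamma>"
  using tring_nonneg[OF \<gamma>] by (auto simp: Psi_eq[OF Phi_SN[OF \<gamma>]] Phi_tp_same[OF \<gamma>])

section \<open>Recovering an algebra seminorm from its operator seminorm\<close>

lemma Psi_square: "\<alpha> \<in> SNl \<Longrightarrow> (Psi Left scale tp \<alpha> x)\<^sup>2 = \<alpha> (tp x x)"
  using SN_nonneg[OF _ tp_mem] by (simp add: Psi_eq)

text \<open>Apply submultiplicativity to
  \<open>tp (a z) (a z) = a \<circ> (tp z z \<circ> adj a)\<close> and use that \<open>adj\<close>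
  is isometric.\<close>

lemma Phi_Psi_le:
  assumes \<alpha>: "\<alpha> \<in> SNl" and a: "a \<in> A"
  shows "Phi Left scale tp (Psi Left scale tp \<alpha>) a \<le> \<alpha> a"
proof (rule Phi_least[OF Psi_tring_SN[OF \<alpha>] a])
  show an: "0 \<le> \<alpha> a" by (rule SN_nonneg[OF \<alpha> a])
  fix z
  have "tp (a z) (a z) = a \<circ> (tp z z \<circ> adj a)"
    using tp_adj[OF a, of z z] E0_comp_tp[OF a, of z "a z"] by simp
  then have "\<alpha> (tp (a z) (a z)) \<le> \<alpha> a * \<alpha> (tp z z \<circ> adj a)"
    using SN_mult[OF \<alpha> a comp_mem[OF tp_mem adj_mem[OF a]]] by simp
  also have "\<dots> \<le> \<alpha> a * (\<alpha> (tp z z) * \<alpha> a)"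
    using SN_mult[OF \<alpha> tp_mem adj_mem[OF a], of z z] SN_adj[OF \<alpha> a] an
    by (intro mult_left_mono) auto
  finally have "(Psi Left scale tp \<alpha> (a z))\<^sup>2 \<le> (\<alpha> a * Psi Left scale tp \<alpha> z)\<^sup>2"
    by (simp add: Psi_square[OF \<alpha>] power_mult_distrib power2_eq_square[of "\<alpha> a"] mult_ac)
  then show "Psi Left scale tp \<alpha> (a z) \<le> \<alpha> a * Psi Left scale tp \<alpha> z"
    using an SN_nonneg[OF \<alpha> tp_mem]
    by (intro power2_le_imp_le[OF _ mult_nonneg_nonneg]) (simp_all add: Psi_eq[OF \<alpha>])
qed

text \<open>For \<open>a = tp x y\<close> the product \<open>b \<circ> a\<close> is
  \<open>tp (b x) y\<close>, so Cauchy-Schwarz leaves only \<open>Psi\<close> at \<open>b x\<close>,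
  which the operator seminorm of \<open>b\<close> controls. The point is that \<open>C\<close> is
  uniform in \<open>b\<close>.\<close>

lemma SN_comp_bound:
  assumes \<alpha>: "\<alpha> \<in> SNl" and a: "a \<in> A"
  shows "\<exists>C\<ge>0. \<forall>b\<in>A. \<alpha> (b \<circ> a) \<le> C * Phi Left scale tp (Psi Left scale tp \<alpha>) b"
proof -
  let ?g = "Psi Left scale tp \<alpha>"
  let ?p = "Phi Left scale tp ?g"
  note \<gamma> = Psi_tring_SN[OF \<alpha>]
  show ?thesis
    using a
  proof (induction rule: E0_induct[where P = "\<lambda>a. \<exists>C\<ge>0. \<forall>b\<in>A. \<alpha> (b \<circ> a) \<le> C * ?p b"])
    case zero
    show ?case by (intro exI[of _ 0]) (simp add: comp_zero SN_zero[OF \<alpha>])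
  next
    case (step c x y a)
    then obtain C where C: "0 \<le> C" "\<And>b. b \<in> A \<Longrightarrow> \<alpha> (b \<circ> a) \<le> C * ?p b" by blast
    let ?D = "cmod c * (?g x * ?g y) + C"
    have "\<alpha> (b \<circ> (op_scale scale c (tp x y) + a)) \<le> ?D * ?p b" if b: "b \<in> A" for b
    proof -
      have "\<alpha> (b \<circ> (op_scale scale c (tp x y) + a)) \<le> cmod c * \<alpha> (tp (b x) y) + \<alpha> (b \<circ> a)"
        using SN_add[OF \<alpha> scale_mem[OF tp_mem] comp_mem[OF b step(1)], of c "b x" y]
        by (simp add: comp_step[OF b] SN_scale[OF \<alpha> tp_mem])
      also have "\<dots> \<le> cmod c * (?g (b x) * ?g y) + C * ?p b"
        using C(2)[OF b] SN_tp_le[OF \<alpha>, of "b x" y]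
        by (intro add_mono mult_left_mono) (auto simp: Psi_eq[OF \<alpha>] C(1))
      also have "\<dots> \<le> cmod c * ((?p b * ?g x) * ?g y) + C * ?p b"
        by (intro add_mono mult_left_mono mult_right_mono Phi_upper[OF \<gamma> b] tring_nonneg[OF \<gamma>])
           (auto simp: C(1))
      finally show ?thesis by (simp add: algebra_simps)
    qed
    moreover have "0 \<le> ?D" using C tring_nonneg[OF \<gamma>] by simp
    ultimately show ?case by blast
  qed
qed

text \<open>Exponents have the form \<open>Suc n\<close> because the identity \<open>h ^^ 0\<close>
  need not lie in the algebra.\<close>

lemma funpow_Suc_mem: "h \<in> A \<Longrightarrow> h ^^ Suc n \<in> A"
  by (induction n) (simp_all add: comp_mem)

lemma adj_funpow_Suc:
  assumes "h \<in> A" "adj h = h"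
  shows "adj (h ^^ Suc n) = h ^^ Suc n"
proof (induction n)
  case (Suc n)
  have "adj (h ^^ Suc (Suc n)) = adj (h \<circ> h ^^ Suc n)"
    by (simp only: funpow.simps(2))
  also have "\<dots> = h ^^ Suc n \<circ> h"
    by (simp only: adj_comp[OF assms(1) funpow_Suc_mem[OF assms(1)]] Suc assms(2))
  finally show ?case by (simp only: funpow_Suc_right)
qed (simp add: assms)

lemma SN_funpow_le:
  assumes "\<alpha> \<in> SNl" "h \<in> A"
  shows "\<alpha> (h ^^ Suc n) \<le> \<alpha> h ^ Suc n"
proof (induction n)
  case (Suc n)
  have "\<alpha> (h \<circ> h ^^ Suc n) \<le> \<alpha> h * \<alpha> (h ^^ Suc n)"
    by (rule SN_mult[OF assms funpow_Suc_mem[OF assms(2)]])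
  also have "\<dots> \<le> \<alpha> h * \<alpha> h ^ Suc n"
    by (rule mult_left_mono[OF Suc SN_nonneg[OF assms]])
  finally show ?case by (simp only: funpow.simps(2) power_Suc)
qed simp

text \<open>Repeated squaring with the C*-identity turns the inequality of
  \<open>SN_funpow_le\<close> into an equality at these exponents.\<close>

lemma SN_funpow_pow2:
  assumes "\<alpha> \<in> SNl" "h \<in> A" "adj h = h"
  shows "\<alpha> (h ^^ (2 ^ k)) = \<alpha> h ^ (2 ^ k)"
proof (induction k)
  case (Suc k)
  obtain n where n: "2 ^ k = Suc n" by (metis not0_implies_Suc power_not_zero zero_neq_numeral)
  have "\<alpha> (h ^^ (2 ^ Suc k)) = \<alpha> (h ^^ Suc n \<circ> h ^^ Suc n)"
    by (simp only: power_Suc mult_2 funpow_add n)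
  also have "\<dots> = (\<alpha> (h ^^ Suc n))\<^sup>2"
    by (rule SN_selfadj_square[OF assms(1) funpow_Suc_mem[OF assms(2)] adj_funpow_Suc[OF assms(2,3)]])
  also have "\<dots> = (\<alpha> h ^ (2 ^ k))\<^sup>2"
    using Suc by (simp only: n)
  finally show ?case by (simp only: power_Suc power_mult[symmetric] mult.commute[of _ 2])
qed simp

text \<open>The spectral radius argument: with \<open>\<rho> = \<alpha>(h)\<close> and \<open>r\<close> the operator seminorm of \<open>h\<close>,
  \<open>\<rho>\<^sup>n = \<alpha>(h\<^sup>n) \<le> C r\<^sup>n\<^sup>-\<^sup>1\<close> along the powers of two, with \<open>C\<close> independent of \<open>n\<close>.\<close>

lemma SN_le_Phi_Psi_selfadj:
  assumes \<alpha>: "\<alpha> \<in> SNl" and h: "h \<in> A" "adj h = h"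
  shows "\<alpha> h \<le> Phi Left scale tp (Psi Left scale tp \<alpha>) h"
proof (rule ccontr)
  let ?p = "Phi Left scale tp (Psi Left scale tp \<alpha>)"
  note p = Phi_SN[OF Psi_tring_SN[OF \<alpha>]]
  let ?q = "?p h / \<alpha> h"
  assume "\<not> \<alpha> h \<le> ?p h"
  then have pos: "0 < \<alpha> h" and q: "0 \<le> ?q" "?q < 1"
    using SN_nonneg[OF p h(1)] by simp_all
  obtain C where C: "0 \<le> C" "\<And>b. b \<in> A \<Longrightarrow> \<alpha> (b \<circ> h) \<le> C * ?p b"
    using SN_comp_bound[OF \<alpha> h(1)] by blast
  \<comment> \<open>\<open>C + 1\<close> replaces \<open>C\<close> to keep the divisor
    positive.\<close>
  obtain N where "?q ^ N < \<alpha> h / (C + 1)"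
    using real_arch_pow_inv[of "\<alpha> h / (C + 1)" ?q] pos q C by auto
  then have N: "(C + 1) * ?q ^ N < \<alpha> h"
    using C by (simp add: field_simps)
  \<comment> \<open>The exponent is a power of two, written as \<open>Suc (Suc m)\<close>: one
    factor \<open>h\<close> is given up to the constant \<open>C\<close>, and the remaining
    \<open>Suc m\<close> exceed \<open>N\<close>.\<close>
  have "Suc N < 2 ^ Suc N" by (rule less_exp)
  then obtain m where m: "2 ^ Suc N = Suc (Suc m)" "N \<le> m"
    by (metis Suc_le_D Suc_le_mono less_eq_Suc_le)
  have "\<alpha> h ^ Suc (Suc m) = \<alpha> (h ^^ Suc m \<circ> h)"
    using SN_funpow_pow2[OF \<alpha> h, of "Suc N"] unfolding m(1) by (simp only: funpow_Suc_right)
  also have "\<dots> \<le> C * ?p (h ^^ Suc m)"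
    by (rule C(2)[OF funpow_Suc_mem[OF h(1)]])
  also have "\<dots> \<le> C * ?p h ^ Suc m"
    by (rule mult_left_mono[OF SN_funpow_le[OF p h(1)] C(1)])
  finally have "\<alpha> h \<le> C * ?q ^ Suc m"
    using pos by (simp add: power_divide field_simps)
  also have "\<dots> \<le> (C + 1) * ?q ^ N"
    using C q m(2) by (intro mult_mono power_decreasing zero_le_power) auto
  finally show False using N by simp
qed

text \<open>Both seminorms satisfy the C*-identity, so the inequality missing from
  \<open>Phi_Psi_le\<close> follows from the one for the self-adjoint element
  \<open>adj a \<circ> a\<close>.\<close>

lemma Phi_Psi:
  assumes \<alpha>: "\<alpha> \<in> SNl"
  shows "Phi Left scale tp (Psi Left scale tp \<alpha>) = \<alpha>"
proof (rule extensionalityI)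
  let ?p = "Phi Left scale tp (Psi Left scale tp \<alpha>)"
  note p = Phi_SN[OF Psi_tring_SN[OF \<alpha>]]
  show "?p \<in> extensional A" "\<alpha> \<in> extensional A"
    using SN_ext p \<alpha> by auto
  fix a assume a: "a \<in> A"
  have h: "adj a \<circ> a \<in> A" "adj (adj a \<circ> a) = adj a \<circ> a"
    using a by (simp_all add: comp_mem adj_mem adj_comp adj_adj)
  have "(\<alpha> a)\<^sup>2 \<le> (?p a)\<^sup>2"
    using SN_le_Phi_Psi_selfadj[OF \<alpha> h] SN_star[OF \<alpha> a] SN_star[OF p a] by simp
  then have "\<alpha> a \<le> ?p a"
    using SN_nonneg[OF p a] by (rule power2_le_imp_le)
  then show "?p a = \<alpha> a"
    using Phi_Psi_le[OF \<alpha> a] by simp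
qed

text \<open>Monotonicity of \<open>\<Phi>\<close> is not visible from its formula, since a smaller seminorm has a larger
  unit ball. Instead, \<open>\<Psi>\<close> commutes with maxima and is injective.\<close>

lemma Phi_mono:
  assumes \<gamma>: "\<gamma> \<in> tring_SN scale tp" and \<delta>: "\<delta> \<in> tring_SN scale tp" and le: "\<gamma> \<le> \<delta>"
  shows "Phi Left scale tp \<gamma> \<le> Phi Left scale tp \<delta>"
proof (rule le_funI)
  fix a
  let ?F = "{Phi Left scale tp \<gamma>, Phi Left scale tp \<delta>}"
  let ?m = "\<lambda>a\<in>A. SUP \<alpha>\<in>?F. \<alpha> a"
  have m: "?m \<in> SNl"
    using Phi_SN[OF \<gamma>] Phi_SN[OF \<delta>] by (intro SN_Sup) auto
  have sup: "(SUP \<alpha>\<in>?F. \<alpha> a) = max (Phi Left scale tp \<gamma> a) (Phi Left scale tp \<delta> a)" for a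
    by (simp add: cSup_eq_Max)
  have "Psi Left scale tp ?m = \<delta>"
  proof
    fix x
    have "?m (tp x x) = max ((\<gamma> x)\<^sup>2) ((\<delta> x)\<^sup>2)"
      by (simp only: restrict_apply tp_mem if_True sup Phi_tp_same[OF \<gamma>] Phi_tp_same[OF \<delta>])
    also have "\<dots> = (\<delta> x)\<^sup>2"
      using le tring_nonneg[OF \<gamma>] by (intro max_absorb2 power_mono) (auto simp: le_fun_def)
    finally show "Psi Left scale tp ?m x = \<delta> x"
      using tring_nonneg[OF \<delta>, of x] by (simp only: Psi_eq[OF m] real_sqrt_abs abs_of_nonneg)
  qed
  then have eq: "Phi Left scale tp \<delta> = ?m"
    using Phi_Psi[OF m] by simp
  show "Phi Left scale tp \<gamma> a \<le> Phi Left scale tp \<delta> a"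
  proof (cases "a \<in> A")
    case True
    then have "Phi Left scale tp \<delta> a = max (Phi Left scale tp \<gamma> a) (Phi Left scale tp \<delta> a)"
      using fun_cong[OF eq, of a] by (simp only: restrict_apply sup if_True)
    then show ?thesis by simp
  next
    case False
    then show ?thesis
      using SN_ext[OF Phi_SN[OF \<gamma>]] SN_ext[OF Phi_SN[OF \<delta>]] by (simp add: extensional_def)
  qed
qed

section \<open>Order and definiteness seen through \<open>Psi\<close>\<close>

lemma Psi_mono:
  assumes "\<alpha> \<in> SNl" "\<beta> \<in> SNl" "\<alpha> \<le> \<beta>"
  shows "Psi Left scale tp \<alpha> \<le> Psi Left scale tp \<beta>"
  using assms by (auto simp: le_fun_def Psi_eq)

text \<open>This restates definiteness on the ring, where the two sides can be compared. One
  direction uses admissibility; in the other, \<open>Phi_Psi\<close> makes \<open>\<alpha> a\<close>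
  an operator bound, so \<open>\<alpha> a = 0\<close> kills every \<open>a z\<close>.\<close>

lemma N_cs_iff:
  assumes \<alpha>: "\<alpha> \<in> SNl"
  shows "\<alpha> \<in> N_cs Left scale tp \<longleftrightarrow> (\<forall>x. Psi Left scale tp \<alpha> x = 0 \<longrightarrow> x = 0)"
proof (intro iffI allI impI)
  fix x assume "\<alpha> \<in> N_cs Left scale tp" "Psi Left scale tp \<alpha> x = 0"
  then have "tp x x = 0"
    using tp_mem by (simp add: N_cs_def Psi_eq[OF \<alpha>])
  then have "tp x x x = 0" by simp
  then show "x = 0" by (rule admissible)
next
  assume def: "\<forall>x. Psi Left scale tp \<alpha> x = 0 \<longrightarrow> x = 0"
  have "a = 0" if a: "a \<in> A" "\<alpha> a = 0" for a
  proof
    fix z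
    note \<gamma> = Psi_tring_SN[OF \<alpha>]
    have "Psi Left scale tp \<alpha> (a z) \<le> 0"
      using Phi_upper[OF \<gamma> a(1), of z] unfolding Phi_Psi[OF \<alpha>] a(2) by simp
    then have "Psi Left scale tp \<alpha> (a z) = 0"
      using tring_nonneg[OF \<gamma>, of "a z"] by (rule antisym)
    then show "a z = 0 z"
      using def by simp
  qed
  then show "\<alpha> \<in> N_cs Left scale tp" using \<alpha> by (simp add: N_cs_def)
qed

end

section \<open>Passage to the right algebra\<close>

text \<open>The common interface of the left and right algebras. \<open>T\<close> stands for the
  ternary seminorms through which the two are composed, and \<open>N_iff\<close> mentions
  \<open>\<alpha>\<close> only through its image in \<open>T\<close>.\<close>

locale seminorm_correspondence =
  fixes SN N :: "('b \<Rightarrow> real) set" and T :: "('e::zero \<Rightarrow> real) set"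
    and \<Phi> :: "('e \<Rightarrow> real) \<Rightarrow> 'b \<Rightarrow> real" and \<Psi> :: "('b \<Rightarrow> real) \<Rightarrow> 'e \<Rightarrow> real"
  assumes SN_lattice: "lattice (pointwise_order SN)"
    and \<Psi>_mem: "\<alpha> \<in> SN \<Longrightarrow> \<Psi> \<alpha> \<in> T"
    and \<Phi>_mem: "\<gamma> \<in> T \<Longrightarrow> \<Phi> \<gamma> \<in> SN"
    and \<Phi>_\<Psi>: "\<alpha> \<in> SN \<Longrightarrow> \<Phi> (\<Psi> \<alpha>) = \<alpha>"
    and \<Psi>_\<Phi>: "\<gamma> \<in> T \<Longrightarrow> \<Psi> (\<Phi> \<gamma>) = \<gamma>"
    and \<Psi>_mono: "\<alpha> \<in> SN \<Longrightarrow> \<beta> \<in> SN \<Longrightarrow> \<alpha> \<le> \<beta> \<Longrightarrow> \<Psi> \<alpha> \<le> \<Psi> \<beta>"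
    and \<Phi>_mono: "\<gamma> \<in> T \<Longrightarrow> \<delta> \<in> T \<Longrightarrow> \<gamma> \<le> \<delta> \<Longrightarrow> \<Phi> \<gamma> \<le> \<Phi> \<delta>"
    and N_subset: "N \<subseteq> SN"
    and N_iff: "\<alpha> \<in> SN \<Longrightarrow> \<alpha> \<in> N \<longleftrightarrow> (\<forall>x. \<Psi> \<alpha> x = 0 \<longrightarrow> x = 0)"

lemma (in admissible_star_tring) left_correspondence:
  "seminorm_correspondence SNl (N_cs Left scale tp) (tring_SN scale tp)
     (Phi Left scale tp) (Psi Left scale tp)"
  by (rule seminorm_correspondence.intro;
      (rule SN_lattice Psi_tring_SN Phi_SN Phi_Psi Psi_Phi Psi_mono Phi_mono N_cs_iff; assumption)?)
     (auto simp: N_cs_def)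

context admissible_star_tring
begin

text \<open>The right-hand theory of \<open>E\<close> is the left-hand theory of the opposite ternary ring.\<close>

abbreviation opp :: "'a \<Rightarrow> 'a \<Rightarrow> 'a \<Rightarrow> 'a" where
  "opp \<equiv> \<lambda>x y z. tp z y x"

text \<open>Reversal preserves the associativity laws only jointly: the middle law of
  \<open>opp\<close> needs both laws of \<open>tp\<close>.\<close>

lemma admissible_opp: "admissible_star_tring scale opp"
proof (intro admissible_star_tring.intro star_tring.intro vector_space_axioms
    star_tring_axioms.intro admissible_star_tring_axioms.intro)
  show "tp x x x = 0 \<Longrightarrow> x = 0" for x by (rule admissible)
  show "tp v u (tp z y x) = tp v (tp y z u) x" for x y z u v
    by (metis assoc_middle assoc_right)
  show "tp v u (tp z y x) = tp (tp v u z) y x" for x y z u v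
    by (simp add: assoc_right)
qed (simp_all add: linear_first linear_third add_second scale_second)

text \<open>Reversal swaps the two arguments of the bracket. The set of generators, the rule for the
  involution and Cauchy-Schwarz are all symmetric under this swap.\<close>

lemma ip_Right: "ip Right tp x y = ip Left opp y x"
  by (simp add: fun_eq_iff)

lemma E0_Right: "E0 Right scale tp = E0 Left scale opp"
proof -
  have "{ip Right tp x y | x y. True} = {ip Left opp x y | x y. True}"
    unfolding ip_Right by blast
  then show ?thesis unfolding E0_def by simp
qed

lemma E0_star_Right: "E0_star Right scale tp = E0_star Left scale opp"
proof -
  have "is_E0_star Right scale tp = is_E0_star Left scale opp"
    by (rule ext) (unfold is_E0_star_def E0_Right ip_Right, blast)
  then show ?thesis unfolding E0_star_def by simp
qed

text \<open>\<open>op_mult Right\<close> is the reverse of the composition used in the left algebra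
  of \<open>opp\<close>; \<open>star_algebra_SN_opposite\<close> shows that the C*-seminorms are the
  same.\<close>

lemma SN_cs_Right: "SN_cs Right scale tp = SN_cs Left scale opp"
proof -
  interpret opp: admissible_star_tring scale opp by (rule admissible_opp)
  have mult: "op_mult Right = (\<lambda>a b. op_mult Left b a)"
    by (simp add: fun_eq_iff)
  have "star_algebra_SN (op_scale scale) (E0 Right scale tp) (op_mult Right) (E0_star Right scale tp)
      = star_algebra_SN (op_scale scale) (E0 Left scale opp) (op_mult Left) (E0_star Left scale opp)"
    unfolding E0_Right E0_star_Right mult
    by (rule star_algebra_SN_opposite[OF opp.adj_mem opp.adj_adj])
  moreover have "(\<forall>x y. (\<alpha> (ip Left opp y x))\<^sup>2 \<le> \<alpha> (ip Left opp x x) * \<alpha> (ip Left opp y y)) \<longleftrightarrow>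
      (\<forall>x y. (\<alpha> (ip Left opp x y))\<^sup>2 \<le> \<alpha> (ip Left opp x x) * \<alpha> (ip Left opp y y))"
    for \<alpha> :: "_ \<Rightarrow> real"
    by (metis mult.commute)
  ultimately show ?thesis
    unfolding SN_cs_def ip_Right by (simp only:)
qed

lemma N_cs_Right: "N_cs Right scale tp = N_cs Left scale opp"
  unfolding N_cs_def SN_cs_Right E0_Right ..

lemma tring_SN_opp: "tring_SN scale opp = tring_SN scale tp"
proof -
  have "(\<forall>x y z. \<gamma> (tp z y x) \<le> \<gamma> x * \<gamma> y * \<gamma> z) \<longleftrightarrow> (\<forall>x y z. \<gamma> (tp x y z) \<le> \<gamma> x * \<gamma> y * \<gamma> z)"
    for \<gamma> :: "'a \<Rightarrow> real"
    by (metis mult.commute mult.left_commute)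
  then show ?thesis unfolding tring_SN_def by simp
qed

lemma Phi_Right: "Phi Right scale tp = Phi Left scale opp"
  unfolding Phi_def E0_Right tring_SN_opp ..

lemma Psi_Right: "Psi Right scale tp = Psi Left scale opp"
  unfolding Psi_def SN_cs_Right ip_Right ..

lemma right_correspondence:
  "seminorm_correspondence (SN_cs Right scale tp) (N_cs Right scale tp) (tring_SN scale tp)
     (Phi Right scale tp) (Psi Right scale tp)"
  using admissible_star_tring.left_correspondence[OF admissible_opp]
  by (simp only: SN_cs_Right N_cs_Right tring_SN_opp Phi_Right Psi_Right)

end

theorem corollary3p19:
  fixes scale :: "complex \<Rightarrow> 'e::ab_group_add \<Rightarrow> 'e"
    and tp :: "'e \<Rightarrow> 'e \<Rightarrow> 'e \<Rightarrow> 'e"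
  assumes "admissible_star_tring scale tp"
  shows "lattice_isomorphism
           (pointwise_order (SN_cs Left scale tp)) (pointwise_order (SN_cs Right scale tp))
           (Phi Right scale tp \<circ> Psi Left scale tp) \<and>
         (Phi Right scale tp \<circ> Psi Left scale tp) ` N_cs Left scale tp = N_cs Right scale tp \<and>
         (\<forall>\<alpha>\<in>SN_cs Left scale tp.
            (Phi Left scale tp \<circ> Psi Right scale tp)
              ((Phi Right scale tp \<circ> Psi Left scale tp) \<alpha>) = \<alpha>) \<and>
         (\<forall>\<beta>\<in>SN_cs Right scale tp.
            (Phi Right scale tp \<circ> Psi Left scale tp)
              ((Phi Left scale tp \<circ> Psi Right scale tp) \<beta>) = \<beta>)"
proof -
  interpret L: seminorm_correspondence "SN_cs Left scale tp" "N_cs Left scale tp" "tring_SN scale tp"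
      "Phi Left scale tp" "Psi Left scale tp"
    by (rule admissible_star_tring.left_correspondence[OF assms])
  interpret R: seminorm_correspondence "SN_cs Right scale tp" "N_cs Right scale tp"
      "tring_SN scale tp" "Phi Right scale tp" "Psi Right scale tp"
    by (rule admissible_star_tring.right_correspondence[OF assms])
  let ?f = "Phi Right scale tp \<circ> Psi Left scale tp"
  let ?g = "Phi Left scale tp \<circ> Psi Right scale tp"
  \<comment> \<open>The inner \<open>Psi Right\<close> cancels \<open>Phi Right\<close> on ternary
    seminorms, and the outer left pair cancels on algebra seminorms.\<close>
  have gf: "?g (?f \<alpha>) = \<alpha>" and f: "?f \<alpha> \<in> SN_cs Right scale tp"
    if "\<alpha> \<in> SN_cs Left scale tp" for \<alpha>
    using that by (simp_all add: L.\<Psi>_mem R.\<Psi>_\<Phi> R.\<Phi>_mem L.\<Phi>_\<Psi>)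
  have fg: "?f (?g \<beta>) = \<beta>" and g: "?g \<beta> \<in> SN_cs Left scale tp"
    if "\<beta> \<in> SN_cs Right scale tp" for \<beta>
    using that by (simp_all add: R.\<Psi>_mem L.\<Psi>_\<Phi> L.\<Phi>_mem R.\<Phi>_\<Psi>)
  have f_mono: "?f \<alpha> \<le> ?f \<beta>"
    if "\<alpha> \<in> SN_cs Left scale tp" "\<beta> \<in> SN_cs Left scale tp" "\<alpha> \<le> \<beta>" for \<alpha> \<beta>
    using that by (simp add: L.\<Psi>_mem L.\<Psi>_mono R.\<Phi>_mono)
  have g_mono: "?g \<alpha> \<le> ?g \<beta>"
    if "\<alpha> \<in> SN_cs Right scale tp" "\<beta> \<in> SN_cs Right scale tp" "\<alpha> \<le> \<beta>" for \<alpha> \<beta>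
    using that by (simp add: R.\<Psi>_mem R.\<Psi>_mono L.\<Phi>_mono)
  have "bij_betw ?f (SN_cs Left scale tp) (SN_cs Right scale tp)"
    by (rule bij_betw_byWitness[where f' = ?g]) (use gf fg f g in blast)+
  \<comment> \<open>That \<open>?f\<close> reflects the order is the monotonicity of its inverse
    \<open>?g\<close>.\<close>
  then have iso: "lattice_isomorphism (pointwise_order (SN_cs Left scale tp))
      (pointwise_order (SN_cs Right scale tp)) ?f"
    by (rule lattice_isomorphismI[OF L.SN_lattice R.SN_lattice]) (metis f f_mono g_mono gf)
  \<comment> \<open>\<open>Psi Right\<close> maps \<open>?f \<alpha>\<close> back to
    \<open>Psi Left scale tp \<alpha>\<close>, so both criteria from \<open>N_iff\<close> are the
    same condition.\<close>
  have N: "?f \<alpha> \<in> N_cs Right scale tp \<longleftrightarrow> \<alpha> \<in> N_cs Left scale tp"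
    if "\<alpha> \<in> SN_cs Left scale tp" for \<alpha>
    using L.N_iff[OF that] R.N_iff[OF f[OF that]] that by (simp add: L.\<Psi>_mem R.\<Psi>_\<Phi>)
  have "?f ` N_cs Left scale tp = N_cs Right scale tp"
  proof
    show "?f ` N_cs Left scale tp \<subseteq> N_cs Right scale tp"
      using N L.N_subset by blast
    show "N_cs Right scale tp \<subseteq> ?f ` N_cs Left scale tp"
    proof
      fix \<beta> assume \<beta>: "\<beta> \<in> N_cs Right scale tp"
      then have "\<beta> \<in> SN_cs Right scale tp" using R.N_subset by blast
      then show "\<beta> \<in> ?f ` N_cs Left scale tp"
        using \<beta> N[OF g] fg by (metis imageI)
    qed
  qed
  then show ?thesis using iso gf fg by blast
qed

end
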